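(* Let $K$ be an oriented knot in an integral homology 3-sphere $\Sigma$ with exterior $N_K$, let $n\ge 1$, and let $H=H_1(N_K;\mathbb{Z}[t^{\pm1}])$. The fixed point set of the $\mathbb{Z}/n$ action on the character variety $X_n(N_K)$ is $$X_n(N_K)^{\mathbb{Z}/n}=\{\xi_\alpha \mid \alpha=\alpha_{(n,\chi)}\text{ for some character }\chi\colon H\to\mathbb{C}^*\text{ that factors through }H/(t^n-1)\}.$$
   Context: A knot $K$ is an oriented simple closed curve in an integral homology 3-sphere $\Sigma$; $N_K=\Sigma\smallsetminus\tau(K)$, where $\tau(K)$ is an open tubular neighborhood of $K$. Write $\pi=\pi_1(N_K)$ and let $\varepsilon\colon\pi\to H_1(N_K)=\mathbb{Z}$ be the abelianization, with the identification $H_1(N_K)=\mathbb{Z}$ determined by the orientation of $K$. Let $\mu$ be a meridian of $K$, so $\varepsilon(\mu)=1$. $R_n(N_K)$ is the space of representations $\pi\to\mathrm{SL}(n,\mathbb{C})$. For $\alpha\in R_n(N_K)$ its character is $\xi_\alpha\colon\pi\to\mathbb{C}$, $\xi_\alpha(g)=\operatorname{tr}\alpha(g)$, and $X_n(N_K)$ is the $\mathrm{SL}(n,\mathbb{C})$ character variety, whose points are the characters $\xi_\alpha$, $\alpha\in R_n(N_K)$. Action of $\mathbb{Z}/n=\langle\sigma\mid\sigma^n=1\rangle$: with $\omega=e^{2\pi i/n}$, set $(\sigma\cdot\alpha)(g)=\omega^{\varepsilon(g)}\alpha(g)$ for $g\in\pi$. This is an action on $R_n(N_K)$ and it descends to $X_n(N_K)$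 by $\sigma\cdot\xi_\alpha=\xi_{\sigma\cdot\alpha}$. Put $\pi^{(1)}=[\pi,\pi]$ and $\pi^{(2)}=[\pi^{(1)},\pi^{(1)}]$. Then $H=H_1(N_K;\mathbb{Z}[t^{\pm1}])$ is the first homology of the infinite cyclic cover of $N_K$, identified with $\pi^{(1)}/\pi^{(2)}$, with $\mathbb{Z}[t^{\pm1}]$-module structure $t^k\cdot g=\mu^{-k}g\mu^k$. There is an isomorphism $\pi/\pi^{(2)}\cong\mathbb{Z}\ltimes H$, $g\mapsto(\varepsilon(g),\mu^{-\varepsilon(g)}g)$, where the product is $(i,h)(j,k)=(i+j,\,t^jh+k)$ (with $H$ written additively). Representations of $\mathbb{Z}\ltimes H$ are regarded as representations of $\pi$ via $\pi\to\pi/\pi^{(2)}\cong\mathbb{Z}\ltimes H$. Let $\chi\colon H\to\mathbb{C}^*$ be a character (group homomorphism) that factors through $H/(t^n-1)$, and let $z\in S^1\subset\mathbb{C}$ with $z^n=(-1)^{n+1}$. Let $P_z$ be the $n\times n$ matrix with $P_ze_i=z\,e_{i+1}$ for $1\le i<n$ and $P_ze_n=z\,e_1$. Then $\alpha_{(n,\chi)}\colon\mathbb{Z}\ltimes H\to\mathrm{SL}(n,\mathbb{C})$ is the representation $$\alpha_{(n,\chi)}(j,h)=P_z^{\,j}\,\operatorname{diag}\big(\chi(h),\chi(th),\dots,\chi(t^{n-1}h)\big).$$ Its isomorphism type does not depend on the choice of $z$. *)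

theory Defs
  imports
    "HOL-Homology.Homology"
    "HOL-Algebra.Generated_Groups"
    "HOL-Algebra.Elementary_Groups"
    "HOL-Algebra.Group_Action"
    "Jordan_Normal_Form.Determinant"
begin

section \<open>Knots in integral homology 3-spheres\<close>

text \<open>Closed topological 3-manifolds with the integral homology of the 3-sphere. The Hausdorff
  property comes from the type class; second countability follows from compactness.\<close>

definition integral_homology_3_sphere :: "'a::t2_space set \<Rightarrow> bool" where
  "integral_homology_3_sphere S \<longleftrightarrow>
     compact S \<and>
     (\<forall>x\<in>S. \<exists>U. openin (top_of_set S) U \<and> x \<in> U \<and>
        top_of_set U homeomorphic_space Euclidean_space 3) \<and>
     (\<forall>p. homology_group p (top_of_set S) \<cong> homology_group p (nsphere 3))"

text \<open>A knot is given by a parametrization, whose direction is the orientation of the knot.\<close>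

definition knot_in :: "'a::t2_space set \<Rightarrow> (real \<Rightarrow> 'a) \<Rightarrow> bool" where
  "knot_in S K \<longleftrightarrow> simple_path K \<and> pathfinish K = pathstart K \<and> path_image K \<subseteq> S"

text \<open>The tubular neighborhood is the image of $S^1 \times \{|w| < 1\}$; the framing \<open>F\<close> is defined on
  a larger open solid torus, so that the boundary torus is collared. Existence of \<open>F\<close> means that the
  knot is not wild (local flatness). As \<open>F\<close> is arbitrary, both orientations of the ambient manifold
  are covered: it carries the one for which \<open>F\<close> preserves orientation.\<close>

definition tubular_framing ::
    "'a::t2_space set \<Rightarrow> (real \<Rightarrow> 'a) \<Rightarrow> (complex \<times> complex \<Rightarrow> 'a) \<Rightarrow> bool" where
  "tubular_framing S K F \<longleftrightarrow>
     embedding_map (top_of_set (sphere 0 1 \<times> ball 0 2)) (top_of_set S) F \<and>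
     openin (top_of_set S) (F ` (sphere 0 1 \<times> ball 0 2)) \<and>
     (\<forall>s\<in>{0..1}. F (cis (2 * pi * s), 0) = K s)"

definition knot_exterior :: "'a::t2_space set \<Rightarrow> (complex \<times> complex \<Rightarrow> 'a) \<Rightarrow> 'a set" where
  "knot_exterior S F = S - F ` (sphere 0 1 \<times> ball 0 1)"


section \<open>The fundamental group\<close>

definition loops_at :: "'a::topological_space set \<Rightarrow> 'a \<Rightarrow> (real \<Rightarrow> 'a) set" where
  "loops_at S x = {p. path p \<and> path_image p \<subseteq> S \<and> pathstart p = x \<and> pathfinish p = x}"

definition path_class :: "'a::topological_space set \<Rightarrow> (real \<Rightarrow> 'a) \<Rightarrow> (real \<Rightarrow> 'a) set" where
  "path_class S p = {q. homotopic_paths S p q}"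

definition fundamental_group :: "'a::topological_space set \<Rightarrow> 'a \<Rightarrow> (real \<Rightarrow> 'a) set monoid" where
  "fundamental_group S x =
     \<lparr>carrier = path_class S ` loops_at S x,
      monoid.mult = (\<lambda>A B. {r. \<exists>p\<in>A. \<exists>q\<in>B. homotopic_paths S (p +++ q) r}),
      one = path_class S (\<lambda>_. x)\<rparr>"

lemma path_class_eq:
  assumes "homotopic_paths S p q"
  shows "path_class S p = path_class S q"
  using assms unfolding path_class_def
  by (blast intro: homotopic_paths_trans homotopic_paths_sym)

lemma fundamental_group_mult:
  assumes "p \<in> loops_at S x" "q \<in> loops_at S x"
  shows "path_class S p \<otimes>\<^bsub>fundamental_group S x\<^esub> path_class S q = path_class S (p +++ q)"
proof -
  have "homotopic_paths S (p +++ q) (p' +++ q')"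
    if "homotopic_paths S p p'" "homotopic_paths S q q'" for p' q'
    using that assms by (intro homotopic_paths_join) (auto simp: loops_at_def)
  moreover have "homotopic_paths S p p" "homotopic_paths S q q"
    using assms by (auto simp: loops_at_def)
  ultimately show ?thesis
    unfolding fundamental_group_def path_class_def monoid.simps
    by (blast intro: homotopic_paths_trans)
qed

lemma homotopic_paths_const_left:
  assumes "p \<in> loops_at S x"
  shows "homotopic_paths S ((\<lambda>_. x) +++ p) p"
proof (rule homotopic_paths_sym, rule homotopic_paths_reparametrize
    [where f = "\<lambda>t. if t \<le> 1/2 then 0 else 2 *\<^sub>R t - 1"])
  show "continuous_on {0..1} (\<lambda>t::real. if t \<le> 1/2 then 0 else 2 *\<^sub>R t - 1)"
    unfolding split_01
    by (rule continuous_on_cases continuous_intros | force)+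
qed (use assms in \<open>auto simp: loops_at_def joinpaths_def pathstart_def\<close>)

lemma loops_at_join: "p \<in> loops_at S x \<Longrightarrow> q \<in> loops_at S x \<Longrightarrow> p +++ q \<in> loops_at S x"
  by (auto simp: loops_at_def subset_path_image_join)

lemma loops_at_const: "x \<in> S \<Longrightarrow> (\<lambda>_. x) \<in> loops_at S x"
  by (auto simp: loops_at_def path_def path_image_def pathstart_def pathfinish_def)

lemma homotopic_paths_linv_loop:
  assumes "p \<in> loops_at S x"
  shows "homotopic_paths S (reversepath p +++ p) (\<lambda>_. x)"
proof -
  let ?A = "{0..1} \<times> {0..1::real}"
  let ?h = "\<lambda>y. p (1 - fst y * min (2 * snd y) (2 - 2 * snd y))"
  have p: "continuous_on {0..1} p" and im: "\<And>t. 0 \<le> t \<Longrightarrow> t \<le> 1 \<Longrightarrow> p t \<in> S" and p1: "p 1 = x"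
    using assms unfolding loops_at_def path_def path_image_def by (auto simp: pathfinish_def)
  have b: "0 \<le> 1 - s * min (2 * t) (2 - 2 * t)" "1 - s * min (2 * t) (2 - 2 * t) \<le> 1"
    if "0 \<le> s" "s \<le> 1" "0 \<le> t" "t \<le> 1" for s t :: real
    using that mult_le_one[of s "min (2 * t) (2 - 2 * t)"] by (auto simp: min_def)
  have "continuous_on ?A ?h"
    by (intro continuous_on_compose2[OF p] continuous_intros) (use b in auto)
  moreover have "?h \<in> ?A \<rightarrow> S"
    by (rule funcsetI) (use b im in auto)
  ultimately have "homotopic_paths S (\<lambda>_. x) (reversepath p +++ p)"
    unfolding homotopic_paths
    by (intro exI[of _ ?h])
      (auto simp: pathstart_def pathfinish_def joinpaths_def reversepath_def p1 min_def)
  then show ?thesis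
    by (rule homotopic_paths_sym)
qed

lemma group_fundamental_group:
  assumes "x \<in> S"
  shows "group (fundamental_group S x)" (is "group ?G")
proof (rule groupI)
  have C: "carrier ?G = path_class S ` loops_at S x" and one: "\<one>\<^bsub>?G\<^esub> = path_class S (\<lambda>_. x)"
    by (auto simp: fundamental_group_def)
  note M = fundamental_group_mult
  show "A \<otimes>\<^bsub>?G\<^esub> B \<in> carrier ?G" if "A \<in> carrier ?G" "B \<in> carrier ?G" for A B
    using that by (auto simp: C M loops_at_join)
  show "\<one>\<^bsub>?G\<^esub> \<in> carrier ?G"
    using assms by (auto simp: C one loops_at_const)
  show "A \<otimes>\<^bsub>?G\<^esub> B \<otimes>\<^bsub>?G\<^esub> D = A \<otimes>\<^bsub>?G\<^esub> (B \<otimes>\<^bsub>?G\<^esub> D)"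
    if ABD: "A \<in> carrier ?G" "B \<in> carrier ?G" "D \<in> carrier ?G" for A B D
  proof -
    obtain p q r where l: "p \<in> loops_at S x" "q \<in> loops_at S x" "r \<in> loops_at S x"
      and e: "A = path_class S p" "B = path_class S q" "D = path_class S r"
      using ABD C by auto
    have "homotopic_paths S (p +++ (q +++ r)) ((p +++ q) +++ r)"
      using l by (intro homotopic_paths_assoc) (auto simp: loops_at_def)
    then show ?thesis
      using l by (simp add: e M loops_at_join path_class_eq)
  qed
  show "\<one>\<^bsub>?G\<^esub> \<otimes>\<^bsub>?G\<^esub> A = A" if "A \<in> carrier ?G" for A
    using that assms
    by (auto simp: C one M loops_at_const path_class_eq[OF homotopic_paths_const_left])
  show "\<exists>B\<in>carrier ?G. B \<otimes>\<^bsub>?G\<^esub> A = \<one>\<^bsub>?G\<^esub>" if A: "A \<in> carrier ?G" for A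
  proof -
    obtain p where p: "p \<in> loops_at S x" "A = path_class S p"
      using A C by auto
    then have "reversepath p \<in> loops_at S x"
      by (auto simp: loops_at_def)
    with p show ?thesis
      by (intro bexI[of _ "path_class S (reversepath p)"])
        (auto simp: C one M intro!: path_class_eq homotopic_paths_linv_loop)
  qed
qed

text \<open>An element of the knot group is a meridian if it is freely homotopic in the exterior to the
  positively oriented boundary circle of a fibre disc.\<close>

definition meridian ::
    "'a::t2_space set \<Rightarrow> (complex \<times> complex \<Rightarrow> 'a) \<Rightarrow> 'a \<Rightarrow> (real \<Rightarrow> 'a) set \<Rightarrow> bool" where
  "meridian S F x m \<longleftrightarrow>
     m \<in> carrier (fundamental_group (knot_exterior S F) x) \<and>
     (\<exists>p\<in>m. homotopic_loops (knot_exterior S F) p (\<lambda>s. F (1, cis (2 * pi * s))))"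

text \<open>\<open>A\<close> together with \<open>f\<close> is the abelianization of \<open>G\<close>.\<close>

definition abelianization :: "('a, 'm) monoid_scheme \<Rightarrow> ('b, 'n) monoid_scheme \<Rightarrow> ('a \<Rightarrow> 'b) \<Rightarrow> bool" where
  "abelianization G A f \<longleftrightarrow>
     f \<in> hom G A \<and> f ` carrier G = carrier A \<and> kernel G A f = derived G (carrier G)"


section \<open>Characters of representations\<close>

text \<open>The name \<open>trace\<close> belongs to the matrix type of HOL-Analysis.\<close>

definition mat_trace :: "'a::comm_monoid_add mat \<Rightarrow> 'a" where
  "mat_trace A = (\<Sum>i<dim_row A. A $$ (i, i))"

definition SL :: "nat \<Rightarrow> complex mat monoid" where
  "SL n = \<lparr>carrier = {A \<in> carrier_mat n n. Determinant.det A = 1},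
           monoid.mult = (*), one = 1\<^sub>m n\<rparr>"

definition rep_character :: "('g, 'm) monoid_scheme \<Rightarrow> ('g \<Rightarrow> complex mat) \<Rightarrow> 'g \<Rightarrow> complex" where
  "rep_character G \<alpha> = (\<lambda>g\<in>carrier G. mat_trace (\<alpha> g))"

definition character_variety :: "('g, 'm) monoid_scheme \<Rightarrow> nat \<Rightarrow> ('g \<Rightarrow> complex) set" where
  "character_variety G n = rep_character G ` hom G (SL n)"

text \<open>The action of \<open>\<sigma>\<^sup>k\<close>, on representations and on characters. The latter is defined through an
  arbitrary representative; independence of the choice is proved below.\<close>

definition rep_act ::
    "nat \<Rightarrow> ('g \<Rightarrow> int) \<Rightarrow> int \<Rightarrow> ('g \<Rightarrow> complex mat) \<Rightarrow> 'g \<Rightarrow> complex mat" where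
  "rep_act n \<epsilon> k \<alpha> = (\<lambda>g. cis (2 * pi / real n) powi (k * \<epsilon> g) \<cdot>\<^sub>m \<alpha> g)"

definition character_act ::
    "('g, 'm) monoid_scheme \<Rightarrow> nat \<Rightarrow> ('g \<Rightarrow> int) \<Rightarrow> int \<Rightarrow> ('g \<Rightarrow> complex) \<Rightarrow> 'g \<Rightarrow> complex" where
  "character_act G n \<epsilon> k \<xi> =
     rep_character G (rep_act n \<epsilon> k (SOME \<alpha>. \<alpha> \<in> hom G (SL n) \<and> rep_character G \<alpha> = \<xi>))"

definition character_fixed_points ::
    "('g, 'm) monoid_scheme \<Rightarrow> nat \<Rightarrow> ('g \<Rightarrow> int) \<Rightarrow> ('g \<Rightarrow> complex) set" where
  "character_fixed_points G n \<epsilon> =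
     {\<xi> \<in> character_variety G n. \<forall>k\<in>carrier (integer_mod_group n). character_act G n \<epsilon> k \<xi> = \<xi>}"

lemma mat_trace_smult: "mat_trace (c \<cdot>\<^sub>m A) = c * mat_trace A"
  if "A \<in> carrier_mat n n" for A :: "complex mat"
  using that by (auto simp: mat_trace_def sum_distrib_left intro!: sum.cong)

lemma rep_character_rep_act:
  assumes "\<alpha> \<in> hom G (SL n)" "g \<in> carrier G"
  shows "rep_character G (rep_act n \<epsilon> k \<alpha>) g =
           cis (2 * pi / real n) powi (k * \<epsilon> g) * rep_character G \<alpha> g"
proof -
  have "\<alpha> g \<in> carrier_mat n n"
    using assms by (auto simp: hom_def SL_def)
  then show ?thesis
    using assms by (simp add: rep_character_def rep_act_def mat_trace_smult)
qed

lemma character_act_rep_character: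
  assumes "\<alpha> \<in> hom G (SL n)"
  shows "character_act G n \<epsilon> k (rep_character G \<alpha>) = rep_character G (rep_act n \<epsilon> k \<alpha>)"
proof -
  define \<beta> where "\<beta> = (SOME \<beta>. \<beta> \<in> hom G (SL n) \<and> rep_character G \<beta> = rep_character G \<alpha>)"
  have \<beta>: "\<beta> \<in> hom G (SL n) \<and> rep_character G \<beta> = rep_character G \<alpha>"
    unfolding \<beta>_def by (rule someI[of _ \<alpha>]) (use assms in auto)
  have "rep_character G (rep_act n \<epsilon> k \<beta>) g = rep_character G (rep_act n \<epsilon> k \<alpha>) g" for g
  proof (cases "g \<in> carrier G")
    case True
    then show ?thesis using \<beta> assms by (simp add: rep_character_rep_act)
  qed (simp add: rep_character_def)
  then show ?thesis
    unfolding character_act_def \<beta>_def[symmetric] by blast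
qed

lemma rep_act_hom:
  assumes "\<alpha> \<in> hom G (SL n)" "\<epsilon> \<in> hom G integer_group" "n \<ge> 1"
  shows "rep_act n \<epsilon> k \<alpha> \<in> hom G (SL n)"
proof -
  let ?w = "cis (2 * pi / real n)"
  have w: "(?w powi j) ^ n = 1" for j
  proof -
    have "?w ^ n = 1"
      using assms(3) by (simp add: Complex.DeMoivre)
    then show ?thesis
      by (metis power_int_1_left power_int_mult power_int_of_nat mult.commute)
  qed
  have smult: "a \<cdot>\<^sub>m (b \<cdot>\<^sub>m A) = (a * b) \<cdot>\<^sub>m A" for a b :: complex and A
    by (rule eq_matI) auto
  have \<alpha>: "\<alpha> g \<in> carrier_mat n n" "Determinant.det (\<alpha> g) = 1" if "g \<in> carrier G" for g
    using assms(1) that by (auto simp: hom_def SL_def)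
  show ?thesis
  proof (rule homI)
    show "rep_act n \<epsilon> k \<alpha> g \<in> carrier (SL n)" if "g \<in> carrier G" for g
      using \<alpha>[OF that] w by (simp add: rep_act_def SL_def)
    show "rep_act n \<epsilon> k \<alpha> (g \<otimes>\<^bsub>G\<^esub> h) = rep_act n \<epsilon> k \<alpha> g \<otimes>\<^bsub>SL n\<^esub> rep_act n \<epsilon> k \<alpha> h"
      if gh: "g \<in> carrier G" "h \<in> carrier G" for g h
    proof -
      have "\<alpha> (g \<otimes>\<^bsub>G\<^esub> h) = \<alpha> g * \<alpha> h"
        using assms(1) gh by (auto simp: hom_def SL_def)
      moreover have "\<epsilon> (g \<otimes>\<^bsub>G\<^esub> h) = \<epsilon> g + \<epsilon> h"
        using assms(2) gh by (auto simp: hom_def integer_group_def)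
      ultimately show ?thesis
        using \<alpha>(1)[OF gh(1)] \<alpha>(1)[OF gh(2)]
        by (simp add: rep_act_def SL_def distrib_left power_int_add
            mult_smult_distrib[of _ n n _ n] mult_smult_assoc_mat[of _ n n _ n] smult mult.commute)
    qed
  qed
qed


section \<open>The Alexander module and metabelian representations\<close>

text \<open>The Alexander module $H = \pi^{(1)}/\pi^{(2)}$, written multiplicatively.\<close>

definition alexander_module :: "('g, 'm) monoid_scheme \<Rightarrow> 'g set monoid" where
  "alexander_module G =
     (let D = derived G (carrier G) in (G\<lparr>carrier := D\<rparr>) Mod derived G D)"

text \<open>\<open>t\<^sup>k\<close> acts on a coset by conjugating each of its elements.\<close>

definition t_act :: "('g, 'm) monoid_scheme \<Rightarrow> 'g \<Rightarrow> int \<Rightarrow> 'g set \<Rightarrow> 'g set" where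
  "t_act G m k h = (\<lambda>g. m [^]\<^bsub>G\<^esub> (- k) \<otimes>\<^bsub>G\<^esub> g \<otimes>\<^bsub>G\<^esub> m [^]\<^bsub>G\<^esub> k) ` h"

text \<open>The submodule $(t^n - 1) H$.\<close>

definition t_power_minus_one :: "('g, 'm) monoid_scheme \<Rightarrow> 'g \<Rightarrow> nat \<Rightarrow> 'g set set" where
  "t_power_minus_one G m n =
     (\<lambda>h. t_act G m (int n) h \<otimes>\<^bsub>alexander_module G\<^esub> inv\<^bsub>alexander_module G\<^esub> h)
       ` carrier (alexander_module G)"

definition complex_units :: "complex monoid" where
  "complex_units = \<lparr>carrier = {c. c \<noteq> 0}, monoid.mult = (*), one = 1\<rparr>"

definition factors_through_quotient ::
    "('h, 'm) monoid_scheme \<Rightarrow> 'h set \<Rightarrow> ('c, 'n) monoid_scheme \<Rightarrow> ('h \<Rightarrow> 'c) \<Rightarrow> bool" where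
  "factors_through_quotient H B C chi \<longleftrightarrow>
     (\<exists>\<psi>\<in>hom (H Mod B) C. \<forall>h\<in>carrier H. chi h = \<psi> (B #>\<^bsub>H\<^esub> h))"

text \<open>Indices run over $0, \dots, n-1$ instead of $1, \dots, n$.\<close>

definition cyclic_perm_mat :: "nat \<Rightarrow> complex \<Rightarrow> complex mat" where
  "cyclic_perm_mat n z = Matrix.mat n n (\<lambda>(i, j). if i = (j + 1) mod n then z else 0)"

text \<open>The representation $\alpha_{(n,\chi)}$ of the semidirect product of the integers and $H$. The
  integer power of the permutation matrix is taken in the group \<open>SL n\<close>.\<close>

definition metabelian_rep ::
    "('g, 'm) monoid_scheme \<Rightarrow> 'g \<Rightarrow> nat \<Rightarrow> complex \<Rightarrow> ('g set \<Rightarrow> complex) \<Rightarrow> int \<times> 'g set \<Rightarrow> complex mat" where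
  "metabelian_rep G m n z chi = (\<lambda>(j, h).
     cyclic_perm_mat n z [^]\<^bsub>SL n\<^esub> j * mat_diag n (\<lambda>i. chi (t_act G m (int i) h)))"

text \<open>The projection of \<open>G\<close> onto the semidirect product.\<close>

definition metabelian_projection ::
    "('g, 'm) monoid_scheme \<Rightarrow> 'g \<Rightarrow> ('g \<Rightarrow> int) \<Rightarrow> 'g \<Rightarrow> int \<times> 'g set" where
  "metabelian_projection G m \<epsilon> g =
     (\<epsilon> g, derived G (derived G (carrier G)) #>\<^bsub>G\<^esub> (m [^]\<^bsub>G\<^esub> (- \<epsilon> g) \<otimes>\<^bsub>G\<^esub> g))"

end

theory Submission
  imports Defs "Jordan_Normal_Form.Schur_Decomposition"
begin

unbundle no vec_syntax

text \<open>A character is fixed iff it vanishes at all \<open>g\<close> with \<open>n \<nmid> \<epsilon> g\<close>. Let \<open>\<alpha>\<close> have such a character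
  and put \<open>M = \<alpha> m\<close>. The traces of \<open>M, \<dots>, M\<^sup>n\<^sup>-\<^sup>1\<close> vanish, so \<open>M\<close> has \<open>n\<close> distinct eigenvalues, which are
  the \<open>n\<close>-th roots of \<open>(-1)\<^sup>n\<^sup>+\<^sup>1\<close>. In an eigenbasis of \<open>M\<close>, the vanishing of the traces of \<open>\<alpha> (h m\<^sup>k)\<close> for
  \<open>0 < k < n\<close> forces every \<open>\<alpha> h\<close> with \<open>h \<in> \<pi>\<^sup>(\<^sup>1\<^sup>)\<close> to have constant diagonal. Hence the linear span \<open>A\<close> of
  \<open>\<alpha> (\<pi>\<^sup>(\<^sup>1\<^sup>))\<close>, graded by the eigenvalues of conjugation by \<open>M\<close>, has only scalars in degree 1, and averaging
  \<open>X\<close> over the conjugates \<open>M\<^sup>-\<^sup>k X M\<^sup>k\<close> gives \<open>tr X / n\<close>. Any algebra homomorphism \<open>\<phi>: A \<rightarrow> \<complex>\<close> therefore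
  satisfies \<open>tr X = \<Sum>\<^sub>k \<phi> (M\<^sup>-\<^sup>k X M\<^sup>k)\<close>, and \<open>\<chi> = \<phi> \<circ> \<alpha>\<close> is the required character of the Alexander
  module. Such a \<open>\<phi>\<close> exists because the degrees of homogeneous units form a cyclic group: modulo the
  homogeneous non-units, \<open>A\<close> is generated by one unit. Conversely, \<open>\<alpha>\<^sub>(\<^sub>n\<^sub>,\<^sub>\<chi>\<^sub>)\<close> takes values in \<open>SL\<close> since its
  determinant is a homomorphism to an abelian group and so is trivial on \<open>\<pi>\<^sup>(\<^sup>1\<^sup>)\<close>.\<close>

section \<open>Power sums and roots of unity\<close>

text \<open>When the product is expanded, \<open>a i\<close> occurs only with exponents from
  \<open>k\<close> to \<open>k + card W\<close>, all strictly between 0 and \<open>n\<close>. The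
  induction trades one factor for a higher exponent.\<close>

lemma weighted_power_sum_prod_zero:
  fixes a x :: "'i \<Rightarrow> 'a::comm_ring_1"
  assumes "finite W" "\<And>k. 0 < k \<Longrightarrow> k < n \<Longrightarrow> (\<Sum>i\<in>I. x i * a i ^ k) = 0" "0 < k" "k + card W < n"
  shows "(\<Sum>i\<in>I. x i * a i ^ k * (\<Prod>w\<in>W. a i - w)) = 0"
  using assms(1,3,4)
proof (induction W arbitrary: k rule: finite_induct)
  case empty
  then show ?case using assms(2) by simp
next
  case (insert w W)
  have "(\<Sum>i\<in>I. x i * a i ^ k * (\<Prod>w\<in>insert w W. a i - w)) =
      (\<Sum>i\<in>I. x i * a i ^ Suc k * (\<Prod>w\<in>W. a i - w)) - w * (\<Sum>i\<in>I. x i * a i ^ k * (\<Prod>w\<in>W. a i - w))"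
    using insert.hyps by (simp add: sum_distrib_left algebra_simps flip: sum_subtractf)
  also have "\<dots> = 0"
    using insert.IH[of k] insert.IH[of "Suc k"] insert.prems insert.hyps by simp
  finally show ?case .
qed

text \<open>If there were fewer than \<open>n\<close> distinct values, then \<open>X \<Prod> (X - v)\<close>, over all values \<open>v \<noteq> a 0\<close>,
  would be a combination of \<open>X, \<dots>, X\<^sup>n\<^sup>-\<^sup>1\<close> that vanishes at every value except \<open>a 0\<close>.\<close>

lemma power_sums_zero_imp_inj_on:
  fixes a :: "nat \<Rightarrow> complex"
  assumes ps: "\<And>k. 0 < k \<Longrightarrow> k < n \<Longrightarrow> (\<Sum>i<n. a i ^ k) = 0" and nz: "\<And>i. i < n \<Longrightarrow> a i \<noteq> 0"
  shows "inj_on a {..<n}"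
proof (cases "n = 0")
  case False
  define V where "V = a ` {..<n}"
  let ?W = "V - {a 0}"
  show ?thesis
  proof (rule ccontr)
    assume "\<not> inj_on a {..<n}"
    then have "card V < n"
      unfolding V_def using pigeonhole[of a "{..<n}"] card_image_le[of "{..<n}" a] eq_card_imp_inj_on[of "{..<n}" a]
      by fastforce
    have V: "finite V" "a 0 \<in> V"
      using False by (auto simp: V_def)
    then have "card ?W = card V - 1" "card V > 0"
      by (auto simp: card_gt_0_iff)
    with \<open>card V < n\<close> have "1 + card ?W < n" by linarith
    then have "0 = (\<Sum>i<n. 1 * a i ^ 1 * (\<Prod>w\<in>?W. a i - w))"
      using V ps by (intro weighted_power_sum_prod_zero[symmetric]) auto
    \<comment> \<open>The sum counts the indices with value \<open>a 0\<close>. In characteristic 0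
      this count must vanish, although 0 is such an index.\<close>
    also have "\<dots> = (\<Sum>i<n. if a i = a 0 then a 0 * (\<Prod>w\<in>?W. a 0 - w) else 0)"
      using V by (intro sum.cong) (auto simp: V_def prod_zero_iff)
    also have "\<dots> = of_nat (card {i. i < n \<and> a i = a 0}) * (a 0 * (\<Prod>w\<in>?W. a 0 - w))"
      by (simp add: sum.If_cases Collect_conj_eq lessThan_def)
    finally have "card {i. i < n \<and> a i = a 0} = 0"
      using V nz[of 0] False by (auto simp: prod_zero_iff)
    then show False using False by auto
  qed
qed auto

text \<open>The weights \<open>x j - x 0\<close> satisfy the same equations, since constant weights
  do by \<open>ps\<close>. The polynomial with simple roots at 0 and at all values except
  \<open>a 0\<close> and \<open>a i\<close> has degree \<open>n - 1\<close>; it leaves only the term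
  of \<open>i\<close>, because index 0 has weight 0.\<close>

lemma weighted_power_sums_zero_imp_const:
  fixes a x :: "nat \<Rightarrow> complex"
  assumes ps: "\<And>k. 0 < k \<Longrightarrow> k < n \<Longrightarrow> (\<Sum>i<n. a i ^ k) = 0"
    and wps: "\<And>k. 0 < k \<Longrightarrow> k < n \<Longrightarrow> (\<Sum>i<n. x i * a i ^ k) = 0"
    and nz: "\<And>i. i < n \<Longrightarrow> a i \<noteq> 0" and i: "i < n"
  shows "x i = x 0"
proof (cases "i = 0")
  case False
  have inj: "inj_on a {..<n}"
    using ps nz by (rule power_sums_zero_imp_inj_on)
  define W where "W = a ` ({..<n} - {0, i})"
  have "card W = n - 2"
    unfolding W_def using inj i False by (subst card_image) (auto intro: inj_on_subset simp: card_Diff_subset)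
  then have "1 + card W < n" "finite W" using False i by (auto simp: W_def)
  moreover have "(\<Sum>j<n. (x j - x 0) * a j ^ k) = 0" if "0 < k" "k < n" for k
    using ps[OF that] wps[OF that] by (simp add: left_diff_distrib sum_subtractf flip: sum_distrib_left)
  ultimately have "0 = (\<Sum>j<n. (x j - x 0) * a j ^ 1 * (\<Prod>w\<in>W. a j - w))"
    by (intro weighted_power_sum_prod_zero[symmetric]) auto
  also have "\<dots> = (\<Sum>j<n. if j = i then (x i - x 0) * a i * (\<Prod>w\<in>W. a i - w) else 0)"
    by (intro sum.cong) (auto simp: W_def prod_zero_iff)
  also have "\<dots> = (x i - x 0) * a i * (\<Prod>w\<in>W. a i - w)"
    using i by simp
  finally show ?thesis
    using i nz[OF i] inj by (auto simp: W_def inj_on_def)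
qed auto

section \<open>Powers of a primitive root of unity\<close>

lemma cis_pow_eq_one_iff:
  fixes n k :: nat
  assumes n: "0 < n"
  shows "cis (2 * pi / n) ^ k = 1 \<longleftrightarrow> n dvd k"
proof -
  have "cis (2 * pi / n) ^ k = cis (2 * pi / n) ^ (k mod n)"
  proof -
    have "cis (2 * pi / n) ^ k = (cis (2 * pi / n) ^ n) ^ (k div n) * cis (2 * pi / n) ^ (k mod n)"
      by (simp flip: power_mult power_add)
    then show ?thesis using n by (simp add: Complex.DeMoivre)
  qed
  moreover have "cis (2 * pi / n) ^ (k mod n) = 1 \<longleftrightarrow> k mod n = 0"
    using inj_onD[OF bij_betw_imp_inj_on[OF bij_betw_roots_unity[OF n]], of "k mod n" 0] n
    by (auto simp: Complex.DeMoivre mult.commute)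
  ultimately show ?thesis by (simp add: dvd_eq_mod_eq_0)
qed

lemma cis_powi_eq_one_iff:
  fixes n :: nat and k :: int
  assumes n: "0 < n"
  shows "cis (2 * pi / n) powi k = 1 \<longleftrightarrow> int n dvd k"
proof (cases "0 \<le> k")
  case True
  then have "cis (2 * pi / n) powi k = cis (2 * pi / n) ^ nat k" by (simp add: power_int_def)
  then show ?thesis using cis_pow_eq_one_iff[OF n, of "nat k"] True by (simp add: int_dvd_int_iff[symmetric])
next
  case False
  then have "w powi k = inverse (w ^ nat (- k))" for w :: complex
    by (simp add: power_int_def power_inverse)
  then have "cis (2 * pi / n) powi k = inverse (cis (2 * pi / n) ^ nat (- k))" .
  then show ?thesis using cis_pow_eq_one_iff[OF n, of "nat (- k)"] False by (simp add: int_dvd_int_iff[symmetric])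
qed

section \<open>Matrices with traceless powers\<close>

lemma mat_trace_mult_comm:
  fixes A B :: "'a::comm_semiring_1 mat"
  assumes "A \<in> carrier_mat n m" "B \<in> carrier_mat m n"
  shows "mat_trace (A * B) = mat_trace (B * A)"
proof -
  have "mat_trace (A * B) = (\<Sum>i<n. \<Sum>j<m. A $$ (i, j) * B $$ (j, i))"
    using assms by (auto simp: mat_trace_def scalar_prod_def atLeast0LessThan intro!: sum.cong)
  also have "\<dots> = (\<Sum>j<m. \<Sum>i<n. B $$ (j, i) * A $$ (i, j))"
    by (subst sum.swap) (simp add: mult.commute)
  also have "\<dots> = mat_trace (B * A)"
    using assms by (auto simp: mat_trace_def scalar_prod_def atLeast0LessThan intro!: sum.cong)
  finally show ?thesis .
qed

lemma mat_trace_conj: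
  fixes X :: "'a::comm_semiring_1 mat"
  assumes "P \<in> carrier_mat n n" "Q \<in> carrier_mat n n" "X \<in> carrier_mat n n" "Q * P = 1\<^sub>m n"
  shows "mat_trace (P * X * Q) = mat_trace X"
proof -
  have "mat_trace (P * X * Q) = mat_trace (P * (X * Q))"
    using assms by (simp add: assoc_mult_mat[of _ n n _ n _ n])
  also have "\<dots> = mat_trace (X * Q * P)"
    using assms by (intro mat_trace_mult_comm) auto
  also have "X * Q * P = X"
    using assms by (simp add: assoc_mult_mat[of _ n n _ n _ n])
  finally show ?thesis .
qed

lemma upper_triangular_pow:
  fixes B :: "'a::comm_semiring_1 mat"
  assumes B: "B \<in> carrier_mat n n" and ut: "upper_triangular B"
  shows "upper_triangular (B ^\<^sub>m k) \<and> (\<forall>i<n. (B ^\<^sub>m k) $$ (i, i) = (B $$ (i, i)) ^ k)"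
proof (induction k)
  case (Suc k)
  have C: "B ^\<^sub>m k \<in> carrier_mat n n" using B by simp
  have z: "(B ^\<^sub>m k) $$ (i, l) * B $$ (l, j) = 0" if "l < i \<or> j < l" "i < n" "l < n" for i j l
    using that Suc upper_triangularD[of "B ^\<^sub>m k" l i] upper_triangularD[OF ut, of j l] B C by auto
  have e: "(B ^\<^sub>m Suc k) $$ (i, j) = (\<Sum>l<n. (B ^\<^sub>m k) $$ (i, l) * B $$ (l, j))" if "i < n" "j < n" for i j
    using that B C by (simp add: scalar_prod_def atLeast0LessThan)
  have "(B ^\<^sub>m Suc k) $$ (i, j) = 0" if "j < i" "i < n" for i j
  proof -
    have "l < i \<or> j < l" for l using that(1) by linarith
    then show ?thesis
      using that z by (subst e) (auto intro!: sum.neutral simp del: mult_eq_0_iff)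
  qed
  moreover have "(B ^\<^sub>m Suc k) $$ (i, i) = (B $$ (i, i)) ^ Suc k" if "i < n" for i
  proof -
    have "(B ^\<^sub>m Suc k) $$ (i, i) = (\<Sum>l<n. if l = i then (B ^\<^sub>m k) $$ (i, i) * B $$ (i, i) else 0)"
      unfolding e[OF that that]
      by (rule sum.cong) (use z that in \<open>auto simp: nat_neq_iff simp del: mult_eq_0_iff\<close>)
    then show ?thesis using that Suc by (simp add: mult.commute)
  qed
  ultimately show ?case using C B by (auto simp del: pow_mat.simps(2))
qed (use B in auto)

text \<open>A linear relation among eigenvectors stays a relation when each coefficient
  \<open>c j\<close> is multiplied by \<open>a j - w\<close>, because this is the effect of
  \<open>M - w\<close>. Letting \<open>w\<close> run through all eigenvalues but one isolates a
  single eigenvector, so the matrix of eigenvectors is invertible.\<close>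

lemma diagonalizable_if_distinct_eigenvalues:
  fixes M :: "'a::field mat"
  assumes M: "M \<in> carrier_mat n n" and ev: "\<And>i. i < n \<Longrightarrow> eigenvalue M (a i)" and inj: "inj_on a {..<n}"
  obtains P Q where "similar_mat_wit M (mat_diag n a) P Q"
proof -
  obtain v where v: "\<And>i. i < n \<Longrightarrow> eigenvector M (v i) (a i)"
    using ev unfolding eigenvalue_def by metis
  have vc: "v i \<in> carrier_vec n" "v i \<noteq> 0\<^sub>v n" "M *\<^sub>v v i = a i \<cdot>\<^sub>v v i" if "i < n" for i
    using v[OF that] M by (auto simp: eigenvector_def)
  define P where "P = Matrix.mat n n (\<lambda>(i, j). v j $ i)"
  have P: "P \<in> carrier_mat n n" by (simp add: P_def)
  have MP: "M * P = P * mat_diag n a"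
  proof (rule eq_matI)
    fix i j assume "i < dim_row (P * mat_diag n a)" "j < dim_col (P * mat_diag n a)"
    then have ij: "i < n" "j < n" using P by (auto simp: mat_diag_def)
    have "(M * P) $$ (i, j) = (M *\<^sub>v v j) $ i"
      using ij M vc(1)[OF ij(2)] by (auto simp: P_def scalar_prod_def intro!: sum.cong)
    also have "\<dots> = (P * mat_diag n a) $$ (i, j)"
      using ij vc(1,3)[OF ij(2)] by (simp add: mat_diag_mult_right[OF P]) (simp add: P_def)
    finally show "(M * P) $$ (i, j) = (P * mat_diag n a) $$ (i, j)" .
  qed (use M P in \<open>auto simp: mat_diag_def\<close>)
  have entry: "(\<Sum>j<n. v j $ i * c j * (\<Prod>w\<in>W. a j - w)) = 0"
    if "finite W" "\<And>i. i < n \<Longrightarrow> (\<Sum>j<n. v j $ i * c j) = 0" "i < n" for W c i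
    using that
  proof (induction W arbitrary: i rule: finite_induct)
    case (insert w W)
    let ?c = "\<lambda>j. c j * (\<Prod>w\<in>W. a j - w)"
    have IH: "(\<Sum>j<n. v j $ k * ?c j) = 0" if "k < n" for k
      using insert.IH[OF insert.prems(1) that] by (simp add: mult.assoc)
    \<comment> \<open>Row \<open>i\<close> of \<open>M\<close> applied to the relation
      \<open>IH\<close>; the factor \<open>a j\<close> appears because \<open>v j\<close> is an
      eigenvector.\<close>
    have "(\<Sum>j<n. v j $ i * ?c j * a j) = (\<Sum>j<n. (\<Sum>k<n. M $$ (i, k) * v j $ k) * ?c j)"
    proof (rule sum.cong)
      fix j assume "j \<in> {..<n}"
      then have j: "j < n" by simp
      have "(M *\<^sub>v v j) $ i = (a j \<cdot>\<^sub>v v j) $ i"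
        using vc(3)[OF j] by simp
      then have "(\<Sum>k<n. M $$ (i, k) * v j $ k) = a j * v j $ i"
        using M insert.prems(2) vc(1)[OF j] by (simp add: scalar_prod_def atLeast0LessThan)
      then show "v j $ i * ?c j * a j = (\<Sum>k<n. M $$ (i, k) * v j $ k) * ?c j"
        by (simp add: mult_ac)
    qed simp
    also have "\<dots> = (\<Sum>k<n. M $$ (i, k) * (\<Sum>j<n. v j $ k * ?c j))"
      by (simp add: sum_distrib_left sum_distrib_right mult.assoc) (rule sum.swap)
    also have "\<dots> = 0"
      using IH by (simp add: sum.neutral)
    finally have "(\<Sum>j<n. v j $ i * ?c j * a j) - w * (\<Sum>j<n. v j $ i * ?c j) = 0"
      using IH[OF insert.prems(2)] by simp
    moreover have "(\<Sum>j<n. v j $ i * c j * (\<Prod>w\<in>insert w W. a j - w)) =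
        (\<Sum>j<n. v j $ i * ?c j * a j) - w * (\<Sum>j<n. v j $ i * ?c j)"
      using insert.hyps by (simp add: sum_distrib_left algebra_simps flip: sum_subtractf)
    ultimately show ?case by simp
  qed simp
  have "Determinant.det P \<noteq> 0"
  proof
    assume "Determinant.det P = 0"
    then obtain c where c: "c \<in> carrier_vec n" "c \<noteq> 0\<^sub>v n" "P *\<^sub>v c = 0\<^sub>v n"
      using det_0_iff_vec_prod_zero_field[OF P] by auto
    then obtain l where l: "l < n" "c $ l \<noteq> 0"
      by (metis carrier_vecD eq_vecI index_zero_vec(1,2))
    have row: "(\<Sum>j<n. v j $ i * c $ j) = 0" if "i < n" for i
    proof -
      have "(P *\<^sub>v c) $ i = 0" using c(3) that by simp
      then show ?thesis
        using that c(1) by (simp add: P_def scalar_prod_def atLeast0LessThan)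
    qed
    let ?W = "a ` ({..<n} - {l})"
    have nz: "(\<Prod>w\<in>?W. a l - w) \<noteq> 0"
      using inj l by (auto simp: prod_zero_iff inj_on_def)
    have "v l $ i = 0" if "i < n" for i
    proof -
      have "0 = (\<Sum>j<n. v j $ i * c $ j * (\<Prod>w\<in>?W. a j - w))"
        using entry[of ?W "\<lambda>j. c $ j", OF _ row that] by simp
      also have "\<dots> = (\<Sum>j<n. if j = l then v l $ i * c $ l * (\<Prod>w\<in>?W. a l - w) else 0)"
        by (intro sum.cong) (auto simp: prod_zero_iff)
      finally show ?thesis using l nz by simp
    qed
    then have "v l = 0\<^sub>v n"
      using vc(1)[OF l(1)] by (intro eq_vecI) auto
    then show False using vc(2)[OF l(1)] by simp
  qed
  then obtain Q where Q: "Q \<in> carrier_mat n n" "P * Q = 1\<^sub>m n" "Q * P = 1\<^sub>m n"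
    using det_non_zero_imp_unit[OF P, of n] P mat_mult_left_right_inverse
    by (auto simp: Units_def ring_mat_def)
  have "M = P * mat_diag n a * Q"
    using MP Q P M by (simp flip: MP add: assoc_mult_mat[of _ n n _ n _ n])
  then have "similar_mat_wit M (mat_diag n a) P Q"
    using Q P M by (intro similar_mat_witI) auto
  then show thesis by (rule that)
qed

text \<open>In the Schur form \<open>B\<close> the eigenvalues stand on the diagonal, and the trace
  of a power of \<open>M\<close> is their power sum. They are nonzero by the determinant, so
  vanishing power sums make them distinct.\<close>

lemma traceless_powers_imp_diagonalizable:
  fixes M :: "complex mat"
  assumes M: "M \<in> carrier_mat n n" and det: "Determinant.det M \<noteq> 0"
    and tr: "\<And>k. 0 < k \<Longrightarrow> k < n \<Longrightarrow> mat_trace (M ^\<^sub>m k) = 0"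
  obtains a P Q where "similar_mat_wit M (mat_diag n a) P Q" "inj_on a {..<n}" "\<And>i. i < n \<Longrightarrow> a i \<noteq> 0"
    "\<And>k. 0 < k \<Longrightarrow> k < n \<Longrightarrow> (\<Sum>i<n. a i ^ k) = 0"
proof -
  obtain es where es: "char_poly M = (\<Prod>e\<leftarrow>es. [:- e, 1:])"
    using char_poly_factorized[OF M] by blast
  obtain B where B: "B \<in> carrier_mat n n" "upper_triangular B" "similar_mat M B"
    using schur_decomposition_exists[OF M es] by blast
  obtain P Q where PQ: "similar_mat_wit M B P Q"
    using B(3) unfolding similar_mat_def by blast
  note wit = similar_mat_witD2[OF M PQ]
  define a where "a i = B $$ (i, i)" for i
  have ps: "(\<Sum>i<n. a i ^ k) = 0" if "0 < k" "k < n" for k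
  proof -
    have "mat_trace (M ^\<^sub>m k) = mat_trace (P * B ^\<^sub>m k * Q)"
      using similar_mat_wit_pow_id[OF PQ] by simp
    also have "\<dots> = mat_trace (B ^\<^sub>m k)"
      using wit by (intro mat_trace_conj) auto
    also have "\<dots> = (\<Sum>i<n. a i ^ k)"
      using upper_triangular_pow[OF B(1,2)] B(1) by (auto simp: mat_trace_def a_def intro!: sum.cong)
    finally show ?thesis using tr[OF that] by simp
  qed
  have "Determinant.det M = prod_list (diag_mat B)"
    using det_similar[OF B(3)] det_upper_triangular[OF B(2,1)] by simp
  then have nz: "a i \<noteq> 0" if "i < n" for i
    using det that B(1) unfolding prod_list_zero_iff by (auto simp: diag_mat_def a_def)
  have "inj_on a {..<n}"
    using ps nz by (rule power_sums_zero_imp_inj_on)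
  moreover have "eigenvalue M (a i)" if "i < n" for i
  proof -
    have "char_poly M = (\<Prod>e\<leftarrow>diag_mat B. [:- e, 1:])"
      using char_poly_similar[OF B(3)] char_poly_upper_triangular[OF B(1,2)] by simp
    moreover have "a i \<in> set (diag_mat B)"
      using that B(1) by (auto simp: diag_mat_def a_def)
    ultimately show ?thesis
      unfolding eigenvalue_root_char_poly[OF M] by (simp add: linear_poly_root)
  qed
  ultimately show thesis
    using diagonalizable_if_distinct_eigenvalues[OF M, of a] that ps nz by metis
qed

section \<open>Matrix algebras graded by roots of unity\<close>

lemma pow_mat_add:
  assumes "(X :: 'a::semiring_1 mat) \<in> carrier_mat n n"
  shows "X ^\<^sub>m (j + k) = X ^\<^sub>m j * X ^\<^sub>m k"
proof (induction k)
  case (Suc k)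
  then show ?case
    using assms by (simp add: assoc_mult_mat[of _ n n _ n _ n])
qed (use assms in auto)

lemma pow_mat_inverse:
  assumes X: "(X :: 'a::semiring_1 mat) \<in> carrier_mat n n" and W: "W \<in> carrier_mat n n" and "X * W = 1\<^sub>m n"
  shows "X ^\<^sub>m k * W ^\<^sub>m k = 1\<^sub>m n"
proof (induction k)
  case (Suc k)
  have "X ^\<^sub>m Suc k = X * X ^\<^sub>m k"
    using pow_mat_add[OF X, of 1 k] X by simp
  moreover have "X * X ^\<^sub>m k * (W ^\<^sub>m k * W) = X * (X ^\<^sub>m k * (W ^\<^sub>m k * W))"
    using X W by (intro assoc_mult_mat[of _ n n _ n _ n] mult_carrier_mat[of _ n n] pow_carrier_mat)
  moreover have "X ^\<^sub>m k * (W ^\<^sub>m k * W) = X ^\<^sub>m k * W ^\<^sub>m k * W"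
    using X W by (intro assoc_mult_mat[of _ n n _ n _ n, symmetric] pow_carrier_mat)
  ultimately show ?case
    using Suc assms by simp
qed (use assms in auto)

lemma smult_pow_mat:
  assumes "(X :: 'a::comm_semiring_1 mat) \<in> carrier_mat n n"
  shows "(c \<cdot>\<^sub>m X) ^\<^sub>m k = c ^ k \<cdot>\<^sub>m X ^\<^sub>m k"
proof (induction k)
  case (Suc k)
  have "(c ^ k \<cdot>\<^sub>m X ^\<^sub>m k) * (c \<cdot>\<^sub>m X) = c ^ Suc k \<cdot>\<^sub>m (X ^\<^sub>m k * X)"
    using assms by (intro eq_matI) (auto simp: scalar_prod_def sum_distrib_left ac_simps)
  then show ?case
    using Suc by simp
qed (use assms in \<open>auto intro!: eq_matI\<close>)

text \<open>Meant for the powers of a unit \<open>X\<close> with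
  \<open>X ^\<^sub>m d = 1\<^sub>m n\<close>, where multiplication by \<open>X ^\<^sub>m q\<close>
  shifts the index.\<close>

lemma sum_shift_periodic:
  fixes f :: "nat \<Rightarrow> 'a::ab_group_add"
  assumes "\<And>j. f (j + d) = f j"
  shows "(\<Sum>j<d. f (q + j)) = (\<Sum>j<d. f j)"
proof (induction q)
  case (Suc q)
  have "(\<Sum>j<d. f (Suc q + j)) + f q = (\<Sum>j<Suc d. f (q + j))"
    by (simp add: sum.lessThan_Suc_shift del: sum.lessThan_Suc)
  also have "\<dots> = (\<Sum>j<d. f (q + j)) + f q"
    using assms[of q] by simp
  finally show ?case
    using Suc by simp
qed simp

lemma mult_inverse_cancel:
  fixes X :: "'a::semiring_1 mat"
  assumes "X \<in> carrier_mat n n" "Y \<in> carrier_mat n n" "V \<in> carrier_mat n n" "W \<in> carrier_mat n n"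
    and "X * W = 1\<^sub>m n" "Y * V = 1\<^sub>m n"
  shows "(X * Y) * (V * W) = 1\<^sub>m n"
proof -
  have "(X * Y) * (V * W) = X * ((Y * V) * W)"
    using assms(1-4) by (simp add: assoc_mult_mat[of _ n n _ n _ n])
  then show ?thesis using assms by simp
qed

section \<open>Linear spans of sets of matrices\<close>

inductive_set mat_span :: "'a::semiring_1 mat set \<Rightarrow> 'a mat set" for N where
  base: "X \<in> N \<Longrightarrow> X \<in> mat_span N"
| add: "X \<in> mat_span N \<Longrightarrow> Y \<in> mat_span N \<Longrightarrow> X + Y \<in> mat_span N"
| smult: "X \<in> mat_span N \<Longrightarrow> c \<cdot>\<^sub>m X \<in> mat_span N"

lemma mat_span_carrier: "X \<in> mat_span N \<Longrightarrow> N \<subseteq> carrier_mat n k \<Longrightarrow> X \<in> carrier_mat n k"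
  by (induction rule: mat_span.induct) auto

lemma mat_span_mult:
  fixes N :: "'a::comm_semiring_1 mat set"
  assumes N: "N \<subseteq> carrier_mat n n" and m: "\<And>X Y. X \<in> N \<Longrightarrow> Y \<in> N \<Longrightarrow> X * Y \<in> N"
    and X: "X \<in> mat_span N" and Y: "Y \<in> mat_span N"
  shows "X * Y \<in> mat_span N"
proof -
  have C: "Z \<in> carrier_mat n n" if "Z \<in> mat_span N" for Z
    using mat_span_carrier[OF that N] .
  have 1: "X * Y \<in> mat_span N" if X: "X \<in> N" for X
    using Y
  proof (induction Y rule: mat_span.induct)
    case (base Y)
    then show ?case using m X by (auto intro: mat_span.base)
  next
    case (add Y Z)
    then show ?case
      using mat_span.add[OF add(3,4)] C[OF add(1)] C[OF add(2)] N X by (subst mult_add_distrib_mat[of _ n n _ n]) auto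
  next
    case (smult Y c)
    then show ?case
      using mat_span.smult[OF smult(2), of c] C[OF smult(1)] N X by (subst mult_smult_distrib[of _ n n _ n]) auto
  qed
  show ?thesis
    using X
  proof (induction X rule: mat_span.induct)
    case (base X)
    then show ?case by (rule 1)
  next
    case (add X Z)
    then show ?case
      using mat_span.add[OF add(3,4)] C[OF add(1)] C[OF add(2)] C[OF Y] by (subst add_mult_distrib_mat[of _ n n _ _ n]) auto
  next
    case (smult X c)
    then show ?case
      using mat_span.smult[OF smult(2), of c] C[OF smult(1)] C[OF Y] by (subst mult_smult_assoc_mat[of _ n n _ n]) auto
  qed
qed

text \<open>Models the span of the image of the commutator subgroup in an eigenbasis of the meridian
  matrix, which has eigenvalues \<open>a i\<close>. Stability under conjugation by diag(a), stated
  as \<open>twist\<close>, yields the grading.\<close>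

locale graded_mat_algebra =
  fixes n :: nat and a :: "nat \<Rightarrow> complex" and A :: "complex mat set"
  assumes n_pos: "0 < n" and a_nz: "i < n \<Longrightarrow> a i \<noteq> 0" and a_inj: "inj_on a {..<n}"
    and a_pow: "i < n \<Longrightarrow> a i ^ n = a 0 ^ n"
    and carrier: "X \<in> A \<Longrightarrow> X \<in> carrier_mat n n" and one: "1\<^sub>m n \<in> A"
    and add: "X \<in> A \<Longrightarrow> Y \<in> A \<Longrightarrow> X + Y \<in> A" and smult: "X \<in> A \<Longrightarrow> c \<cdot>\<^sub>m X \<in> A"
    and mult: "X \<in> A \<Longrightarrow> Y \<in> A \<Longrightarrow> X * Y \<in> A"
    and twist: "X \<in> A \<Longrightarrow> Matrix.mat n n (\<lambda>(i, j). a j / a i * X $$ (i, j)) \<in> A"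
    and diag: "X \<in> A \<Longrightarrow> i < n \<Longrightarrow> X $$ (i, i) = X $$ (0, 0)"
begin

text \<open>Entry \<open>(i, j)\<close> has degree \<open>a j / a i\<close>, its eigenvalue under \<open>X \<mapsto> diag(a)\<^sup>-\<^sup>1 X diag(a)\<close>.\<close>

definition homog :: "complex \<Rightarrow> complex mat \<Rightarrow> bool" where
  "homog \<zeta> X \<longleftrightarrow> (\<forall>i<n. \<forall>j<n. X $$ (i, j) \<noteq> 0 \<longrightarrow> a j = \<zeta> * a i)"

lemma ratio_pow: "i < n \<Longrightarrow> j < n \<Longrightarrow> (a j / a i) ^ n = 1"
  using a_pow[of i] a_pow[of j] a_nz[of i] a_nz[of 0] n_pos by (simp add: power_divide)

lemma homog_mult:
  assumes "X \<in> carrier_mat n n" "Y \<in> carrier_mat n n" "homog \<zeta> X" "homog \<eta> Y"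
  shows "homog (\<zeta> * \<eta>) (X * Y)"
  unfolding homog_def
proof (intro allI impI)
  fix i j assume ij: "i < n" "j < n" and "(X * Y) $$ (i, j) \<noteq> 0"
  then have "(\<Sum>k<n. X $$ (i, k) * Y $$ (k, j)) \<noteq> 0"
    using assms by (simp add: scalar_prod_def atLeast0LessThan)
  then obtain k where "k < n" "X $$ (i, k) * Y $$ (k, j) \<noteq> 0"
    by (meson lessThan_iff sum.not_neutral_contains_not_neutral)
  then show "a j = \<zeta> * \<eta> * a i"
    using assms(3,4) ij by (auto simp: homog_def)
qed

lemma homog_smult: "X \<in> carrier_mat n n \<Longrightarrow> homog \<zeta> X \<Longrightarrow> homog \<zeta> (c \<cdot>\<^sub>m X)"
  by (auto simp: homog_def)

lemma homog_one: "homog 1 (1\<^sub>m n)"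
  by (auto simp: homog_def)

lemma pow_mem: "X \<in> A \<Longrightarrow> X ^\<^sub>m k \<in> A"
  using carrier[of X] by (induction k) (auto intro: mult one)

lemma homog_pow:
  assumes "X \<in> carrier_mat n n" "homog \<zeta> X"
  shows "homog (\<zeta> ^ k) (X ^\<^sub>m k)"
proof (induction k)
  case (Suc k)
  then show ?case
    using homog_mult[OF pow_carrier_mat[OF assms(1)] assms(1) Suc assms(2)] by (simp add: mult.commute)
qed (use assms homog_one in auto)

text \<open>As the \<open>a i\<close> are distinct, only diagonal positions have degree 1, and
  \<open>diag\<close> makes their entries equal.\<close>

lemma homog_one_scalar:
  assumes "X \<in> A" "homog 1 X"
  shows "X = X $$ (0, 0) \<cdot>\<^sub>m 1\<^sub>m n"
proof (rule eq_matI)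
  fix i j assume "i < dim_row (X $$ (0, 0) \<cdot>\<^sub>m 1\<^sub>m n)" "j < dim_col (X $$ (0, 0) \<cdot>\<^sub>m 1\<^sub>m n)"
  then have ij: "i < n" "j < n" by auto
  then have "X $$ (i, j) = 0" if "i \<noteq> j"
    using that ij assms(2) inj_onD[OF a_inj, of j i] by (auto simp: homog_def)
  then show "X $$ (i, j) = (X $$ (0, 0) \<cdot>\<^sub>m 1\<^sub>m n) $$ (i, j)"
    using ij diag[OF assms(1) ij(1)] by (cases "i = j") auto
qed (use carrier[OF assms(1)] in auto)

lemma homog_diag_zero: "homog \<zeta> X \<Longrightarrow> \<zeta> \<noteq> 1 \<Longrightarrow> X $$ (0, 0) = 0"
  using n_pos a_nz[of 0] unfolding homog_def by (metis mult_cancel_right1)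

section \<open>Degrees of homogeneous units\<close>

definition unit_degree :: "complex \<Rightarrow> bool" where
  "unit_degree \<zeta> \<longleftrightarrow> (\<exists>X\<in>A. \<exists>W\<in>A. homog \<zeta> X \<and> homog (inverse \<zeta>) W \<and> X * W = 1\<^sub>m n \<and> W * X = 1\<^sub>m n)"

lemma unit_degree_mult:
  assumes "unit_degree \<zeta>" "unit_degree \<eta>"
  shows "unit_degree (\<zeta> * \<eta>)"
proof -
  obtain X W where X: "X \<in> A" "W \<in> A" "homog \<zeta> X" "homog (inverse \<zeta>) W" "X * W = 1\<^sub>m n" "W * X = 1\<^sub>m n"
    using assms(1) by (auto simp: unit_degree_def)
  obtain Y V where Y: "Y \<in> A" "V \<in> A" "homog \<eta> Y" "homog (inverse \<eta>) V" "Y * V = 1\<^sub>m n" "V * Y = 1\<^sub>m n"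
    using assms(2) by (auto simp: unit_degree_def)
  have "(X * Y) * (V * W) = 1\<^sub>m n" "(V * W) * (X * Y) = 1\<^sub>m n"
    using X Y carrier by (simp_all add: mult_inverse_cancel)
  moreover have "homog (\<zeta> * \<eta>) (X * Y)" "homog (inverse (\<zeta> * \<eta>)) (V * W)"
    using X Y carrier homog_mult[of X Y \<zeta> \<eta>] homog_mult[of V W "inverse \<eta>" "inverse \<zeta>"]
    by (simp_all add: mult.commute[of "inverse \<zeta>"])
  ultimately show ?thesis
    using X Y mult unfolding unit_degree_def by blast
qed

lemma unit_degree_inverse: "unit_degree \<zeta> \<Longrightarrow> unit_degree (inverse \<zeta>)"
  unfolding unit_degree_def by auto

lemma unit_degree_one: "unit_degree 1"
  unfolding unit_degree_def using one homog_one
  by (intro bexI[of _ "1\<^sub>m n"] conjI) auto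

lemma unit_degree_pow: "unit_degree \<zeta> \<Longrightarrow> unit_degree (\<zeta> ^ k)"
  by (induction k) (auto intro: unit_degree_one unit_degree_mult)

text \<open>The product has degree 1 and is therefore a scalar; as it is nonzero, a multiple of
  \<open>Z\<close> is inverse to \<open>X\<close>.\<close>

lemma unit_degreeI:
  assumes X: "X \<in> A" "homog \<zeta> X" and Z: "Z \<in> A" "homog \<eta> Z" and "\<zeta> * \<eta> = 1"
    and nz: "(X * Z) $$ (0, 0) \<noteq> 0"
  shows "unit_degree \<zeta>"
proof -
  let ?c = "(X * Z) $$ (0, 0)"
  have C: "X \<in> carrier_mat n n" "Z \<in> carrier_mat n n" using X Z carrier by auto
  have "homog 1 (X * Z)"
    using homog_mult[OF C X(2) Z(2)] assms(5) by simp
  then have XZ: "X * Z = ?c \<cdot>\<^sub>m 1\<^sub>m n"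
    using homog_one_scalar X Z mult by blast
  define W where "W = inverse ?c \<cdot>\<^sub>m Z"
  have "X * W = inverse ?c \<cdot>\<^sub>m (X * Z)"
    unfolding W_def using C by (simp add: mult_smult_distrib[of _ n n _ n])
  also have "\<dots> = inverse ?c \<cdot>\<^sub>m (?c \<cdot>\<^sub>m 1\<^sub>m n)"
    using XZ by simp
  also have "\<dots> = 1\<^sub>m n"
    using nz by (intro eq_matI) auto
  finally have XW: "X * W = 1\<^sub>m n" .
  moreover have "W * X = 1\<^sub>m n"
    using mat_mult_left_right_inverse[OF C(1) _ XW] C by (simp add: W_def)
  moreover have "homog (inverse \<zeta>) W"
    using homog_smult[OF C(2) Z(2)] inverse_unique[OF assms(5)] by (simp add: W_def)
  ultimately show ?thesis
    using X Z smult unfolding unit_degree_def W_def by blast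
qed

text \<open>The operator twist minus \<open>w\<close> preserves \<open>A\<close> and multiplies each
  entry by its degree minus \<open>w\<close>; these operators are composed over
  \<open>W\<close>.\<close>

lemma prod_twist_mem:
  assumes "finite W" "X \<in> A"
  shows "Matrix.mat n n (\<lambda>(i, j). (\<Prod>w\<in>W. a j / a i - w) * X $$ (i, j)) \<in> A"
  using assms(1)
proof (induction W rule: finite_induct)
  case empty
  have "Matrix.mat n n (\<lambda>(i, j). (\<Prod>w\<in>{}. a j / a i - w) * X $$ (i, j)) = X"
    using carrier[OF assms(2)] by (intro eq_matI) auto
  then show ?case using assms(2) by simp
next
  case (insert w W)
  let ?Y = "Matrix.mat n n (\<lambda>(i, j). (\<Prod>w\<in>W. a j / a i - w) * X $$ (i, j))"
  have "Matrix.mat n n (\<lambda>(i, j). (\<Prod>w\<in>insert w W. a j / a i - w) * X $$ (i, j)) =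
      Matrix.mat n n (\<lambda>(i, j). a j / a i * ?Y $$ (i, j)) + (- w) \<cdot>\<^sub>m ?Y"
    using insert.hyps by (intro eq_matI) (auto simp: algebra_simps)
  then show ?case
    using twist[OF insert.IH] smult[OF insert.IH] add by simp
qed

definition component :: "complex set \<Rightarrow> complex mat \<Rightarrow> complex mat" where
  "component F X = Matrix.mat n n (\<lambda>(i, j). if a j / a i \<in> F then X $$ (i, j) else 0)"

text \<open>Lagrange interpolation: the product over the other \<open>n\<close>-th roots of unity
  vanishes on every other degree and is a nonzero constant on degree \<zeta>.\<close>

lemma component_single_mem:
  assumes "X \<in> A" "\<zeta> ^ n = 1"
  shows "component {\<zeta>} X \<in> A"
proof -
  let ?W = "{w. w ^ n = 1} - {\<zeta>}"
  let ?p = "\<Prod>w\<in>?W. \<zeta> - w"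
  have fin: "finite ?W" using n_pos by (auto intro: finite_roots_unity)
  then have p: "?p \<noteq> 0" by (auto simp: prod_zero_iff)
  have "(\<Prod>w\<in>?W. a j / a i - w) = (if a j / a i = \<zeta> then ?p else 0)" if "i < n" "j < n" for i j
    using that fin ratio_pow[OF that] by (auto simp: prod_zero_iff)
  then have "component {\<zeta>} X = inverse ?p \<cdot>\<^sub>m Matrix.mat n n (\<lambda>(i, j). (\<Prod>w\<in>?W. a j / a i - w) * X $$ (i, j))"
    unfolding component_def using p by (intro eq_matI) auto
  then show ?thesis
    using prod_twist_mem[OF fin assms(1)] smult by simp
qed

lemma homog_component: "homog \<zeta> (component {\<zeta>} X)"
  using a_nz by (auto simp: homog_def component_def split: if_splits)

text \<open>All degrees that occur are \<open>n\<close>-th roots of unity by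
  \<open>ratio_pow\<close>, so \<open>X\<close> is a finite sum of homogeneous components, which are
  added one at a time.\<close>

lemma homog_induct [consumes 1, case_names homog add]:
  assumes X: "X \<in> A"
    and h: "\<And>\<zeta> Y. Y \<in> A \<Longrightarrow> \<zeta> ^ n = 1 \<Longrightarrow> homog \<zeta> Y \<Longrightarrow> P Y"
    and a: "\<And>Y Z. Y \<in> A \<Longrightarrow> Z \<in> A \<Longrightarrow> P Y \<Longrightarrow> P Z \<Longrightarrow> P (Y + Z)"
  shows "P X"
proof -
  have "component F X \<in> A \<and> P (component F X)" if "finite F" "F \<subseteq> {\<zeta>. \<zeta> ^ n = 1}" for F
    using that
  proof (induction F rule: finite_induct)
    case empty
    \<comment> \<open>The empty sum is the zero matrix, which is homogeneous of every degree, in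
      particular of degree 1.\<close>
    have "component {} X = 0 \<cdot>\<^sub>m X"
      unfolding component_def using carrier[OF X] by (intro eq_matI) auto
    moreover have "homog 1 (0 \<cdot>\<^sub>m X)"
      using carrier[OF X] by (auto simp: homog_def)
    ultimately show ?case
      using smult[OF X, of 0] h[of "0 \<cdot>\<^sub>m X" 1] by simp
  next
    case (insert \<zeta> F)
    have "component (insert \<zeta> F) X = component {\<zeta>} X + component F X"
      unfolding component_def using insert.hyps by (intro eq_matI) auto
    moreover have "component {\<zeta>} X \<in> A" "P (component {\<zeta>} X)"
      using component_single_mem[OF X] homog_component insert.prems h by auto
    ultimately show ?case
      using insert add a by simp
  qed
  moreover have "component {\<zeta>. \<zeta> ^ n = 1} X = X"
    unfolding component_def using carrier[OF X] ratio_pow by (intro eq_matI) auto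
  ultimately show ?thesis
    using finite_roots_unity[of n] n_pos by (metis One_nat_def Suc_leI order_refl)
qed

section \<open>An algebra homomorphism to the complex numbers\<close>

abbreviation "\<omega> \<equiv> cis (2 * pi / n)"

lemma root_of_unity_obtain:
  assumes "\<zeta> ^ n = 1"
  obtains k where "\<zeta> = \<omega> ^ k"
  using bij_betw_imp_surj_on[OF bij_betw_roots_unity[OF n_pos]] assms
  by (auto simp: Complex.DeMoivre mult.commute set_eq_iff image_iff)

text \<open>The exponents \<open>k\<close> with \<open>unit_degree (\<omega> ^ k)\<close> include
  \<open>n\<close>, and the least positive one, \<open>s\<close>, divides them all. A unit
  \<open>X\<close> of degree \<open>\<omega> ^ s\<close> has a \<open>d\<close>-th power of degree
  1, hence a scalar, which rescaling of \<open>X\<close> turns into 1.\<close>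

lemma obtain_homogeneous_generator:
  obtains d s X W where "0 < d" "s * d = n" "X \<in> A" "W \<in> A" "X * W = 1\<^sub>m n" "W * X = 1\<^sub>m n"
    "X ^\<^sub>m d = 1\<^sub>m n" "homog (\<omega> ^ s) X" "homog (inverse (\<omega> ^ s)) W"
    "\<And>k. unit_degree (\<omega> ^ k) \<Longrightarrow> s dvd k"
proof -
  define s where "s = (LEAST k. 0 < k \<and> unit_degree (\<omega> ^ k))"
  have "\<omega> ^ n = 1"
    using cis_pow_eq_one_iff[OF n_pos, of n] by simp
  then have ex: "0 < n \<and> unit_degree (\<omega> ^ n)"
    using n_pos unit_degree_one by simp
  have s: "0 < s" "unit_degree (\<omega> ^ s)"
    unfolding s_def using LeastI[of "\<lambda>k. 0 < k \<and> unit_degree (\<omega> ^ k)", OF ex] by auto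
  have dvd: "s dvd k" if "unit_degree (\<omega> ^ k)" for k
  proof -
    \<comment> \<open>Division with remainder: a positive remainder would contradict the minimality
      of \<open>s\<close>.\<close>
    have "\<omega> ^ k = (\<omega> ^ s) ^ (k div s) * \<omega> ^ (k mod s)"
      by (simp flip: power_mult power_add)
    then have "\<omega> ^ (k mod s) = \<omega> ^ k * (inverse (\<omega> ^ s)) ^ (k div s)"
      by (simp add: field_simps)
    then have "unit_degree (\<omega> ^ (k mod s))"
      using that s unit_degree_mult unit_degree_pow unit_degree_inverse by metis
    then have "\<not> 0 < k mod s"
      using not_less_Least[of "k mod s" "\<lambda>k. 0 < k \<and> unit_degree (\<omega> ^ k)"] s unfolding s_def[symmetric]
      by (meson mod_less_divisor)
    then show ?thesis by (simp add: dvd_eq_mod_eq_0)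
  qed
  from dvd ex obtain d where d: "n = s * d" by blast
  with n_pos have "0 < d" by (cases d) auto
  obtain X W where X: "X \<in> A" "W \<in> A" "homog (\<omega> ^ s) X" "homog (inverse (\<omega> ^ s)) W"
      "X * W = 1\<^sub>m n" "W * X = 1\<^sub>m n"
    using s unfolding unit_degree_def by auto
  have C: "X \<in> carrier_mat n n" "W \<in> carrier_mat n n" using X carrier by auto
  define x where "x = (X ^\<^sub>m d) $$ (0, 0)"
  have "homog 1 (X ^\<^sub>m d)"
    using homog_pow[OF C(1) X(3), of d] \<open>\<omega> ^ n = 1\<close> d by (simp flip: power_mult)
  then have Xd: "X ^\<^sub>m d = x \<cdot>\<^sub>m 1\<^sub>m n"
    unfolding x_def using homog_one_scalar pow_mem X by blast
  \<comment> \<open>The power is invertible with inverse \<open>W ^\<^sub>m d\<close>, so the scalar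
    cannot vanish.\<close>
  have "x \<noteq> 0"
  proof
    assume "x = 0"
    then have "X ^\<^sub>m d = 0\<^sub>m n n"
      using Xd by (auto intro!: eq_matI)
    then have "X ^\<^sub>m d * W ^\<^sub>m d = 0\<^sub>m n n"
      using left_mult_zero_mat[OF pow_carrier_mat[OF C(2)]] by simp
    then have "(1\<^sub>m n :: complex mat) $$ (0, 0) = 0"
      using pow_mat_inverse[OF C X(5)] n_pos by simp
    then show False using n_pos by simp
  qed
  \<comment> \<open>A \<open>d\<close>-th root \<open>c\<close> of \<open>x\<close> exists by
    counting; \<open>X\<close> is then divided by \<open>c\<close>.\<close>
  have "card {c. c ^ d = x} = d"
    using \<open>x \<noteq> 0\<close> \<open>0 < d\<close> by (simp add: card_nth_roots)
  then have "{c. c ^ d = x} \<noteq> {}"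
    using \<open>0 < d\<close> by (metis card.empty less_irrefl)
  then obtain c where c: "c ^ d = x" "c \<noteq> 0"
    using \<open>x \<noteq> 0\<close> \<open>0 < d\<close> by (auto simp: power_0_left)
  show ?thesis
  proof
    show "0 < d" "s * d = n" using \<open>0 < d\<close> d by auto
    show "inverse c \<cdot>\<^sub>m X \<in> A" "c \<cdot>\<^sub>m W \<in> A" using X smult by auto
    show "inverse c \<cdot>\<^sub>m X * (c \<cdot>\<^sub>m W) = 1\<^sub>m n" "c \<cdot>\<^sub>m W * (inverse c \<cdot>\<^sub>m X) = 1\<^sub>m n"
    proof -
      have "inverse c \<cdot>\<^sub>m X * (c \<cdot>\<^sub>m W) = X * W" "c \<cdot>\<^sub>m W * (inverse c \<cdot>\<^sub>m X) = W * X"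
        using C c by (auto intro!: eq_matI sum.cong simp: scalar_prod_def)
      then show "inverse c \<cdot>\<^sub>m X * (c \<cdot>\<^sub>m W) = 1\<^sub>m n" "c \<cdot>\<^sub>m W * (inverse c \<cdot>\<^sub>m X) = 1\<^sub>m n"
        using X by auto
    qed
    have "(inverse c \<cdot>\<^sub>m X) ^\<^sub>m d = inverse x \<cdot>\<^sub>m (x \<cdot>\<^sub>m 1\<^sub>m n)"
      using C Xd c by (simp add: smult_pow_mat power_inverse)
    also have "\<dots> = 1\<^sub>m n"
      using \<open>x \<noteq> 0\<close> by (intro eq_matI) auto
    finally show "(inverse c \<cdot>\<^sub>m X) ^\<^sub>m d = 1\<^sub>m n" .
    show "homog (\<omega> ^ s) (inverse c \<cdot>\<^sub>m X)" "homog (inverse (\<omega> ^ s)) (c \<cdot>\<^sub>m W)"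
      using C X homog_smult by auto
  qed (rule dvd)
qed

text \<open>With \<open>X\<close> the generating unit, \<open>\<phi> Y\<close> adds up the coefficients of the powers of \<open>X\<close> in \<open>Y\<close>: the one
  of \<open>X\<^sup>-\<^sup>j\<close> is the constant diagonal entry of \<open>Y X\<^sup>j\<close>. A homogeneous \<open>Y\<close> whose degree is not that of a unit
  is killed by \<open>\<phi>\<close>, together with all its multiples, because a nonzero scalar \<open>V Y X\<^sup>j\<close> would make \<open>V\<close>,
  and then the degree of \<open>Y\<close>, a unit.\<close>

lemma obtain_character:
  obtains \<phi> :: "complex mat \<Rightarrow> complex" where "\<phi> (1\<^sub>m n) = 1"
    "\<And>Y Z. Y \<in> A \<Longrightarrow> Z \<in> A \<Longrightarrow> \<phi> (Y + Z) = \<phi> Y + \<phi> Z"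
    "\<And>c Y. Y \<in> A \<Longrightarrow> \<phi> (c \<cdot>\<^sub>m Y) = c * \<phi> Y"
    "\<And>Y Z. Y \<in> A \<Longrightarrow> Z \<in> A \<Longrightarrow> \<phi> (Y * Z) = \<phi> Y * \<phi> Z"
proof -
  obtain d s X W where d: "0 < d" "s * d = n" and X: "X \<in> A" "W \<in> A" "X * W = 1\<^sub>m n" "W * X = 1\<^sub>m n"
    "X ^\<^sub>m d = 1\<^sub>m n" "homog (\<omega> ^ s) X" "homog (inverse (\<omega> ^ s)) W"
    and dvd: "\<And>k. unit_degree (\<omega> ^ k) \<Longrightarrow> s dvd k"
    by (rule obtain_homogeneous_generator) blast
  have C: "X \<in> carrier_mat n n" "W \<in> carrier_mat n n" using X carrier by auto
  note C' = pow_carrier_mat[OF C(1)] pow_carrier_mat[OF C(2)]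
  have unit: "unit_degree (\<omega> ^ s)"
    using X unfolding unit_degree_def by blast
  define \<phi> where "\<phi> Y = (\<Sum>j<d. (Y * X ^\<^sub>m j) $$ (0, 0))" for Y
  have one': "\<phi> (1\<^sub>m n) = 1"
  proof -
    \<comment> \<open>The degree \<open>\<omega> ^ (s * j)\<close> differs from 1 because
      \<open>0 < s * j < n\<close>. Only \<open>j = 0\<close> contributes to
      \<open>\<phi> (1\<^sub>m n)\<close>.\<close>
    have "(X ^\<^sub>m j) $$ (0, 0) = 0" if "0 < j" "j < d" for j
    proof -
      have "0 < s" using d n_pos by (cases s) auto
      then have "s * j < s * d" "0 < s * j" using that by auto
      then have "\<not> n dvd s * j" using d by (auto dest: dvd_imp_le)
      then have "(\<omega> ^ s) ^ j \<noteq> 1"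
        using cis_pow_eq_one_iff[OF n_pos] by (simp flip: power_mult)
      then show ?thesis
        using homog_pow[OF C(1) X(6), of j] homog_diag_zero by blast
    qed
    then have "\<phi> (1\<^sub>m n) = (\<Sum>j<d. if j = 0 then 1 else 0)"
      unfolding \<phi>_def using C n_pos by (intro sum.cong) auto
    then show ?thesis using d by simp
  qed
  have add': "\<phi> (Y + Z) = \<phi> Y + \<phi> Z" if "Y \<in> A" "Z \<in> A" for Y Z
  proof -
    have "((Y + Z) * X ^\<^sub>m j) $$ (0, 0) = (Y * X ^\<^sub>m j) $$ (0, 0) + (Z * X ^\<^sub>m j) $$ (0, 0)" for j
      using carrier[OF that(1)] carrier[OF that(2)] C'(1)[of j] n_pos
      by (subst add_mult_distrib_mat[of _ n n _ _ n]) auto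
    then show ?thesis by (simp add: \<phi>_def sum.distrib)
  qed
  have smult': "\<phi> (c \<cdot>\<^sub>m Y) = c * \<phi> Y" if "Y \<in> A" for c Y
  proof -
    have "((c \<cdot>\<^sub>m Y) * X ^\<^sub>m j) $$ (0, 0) = c * (Y * X ^\<^sub>m j) $$ (0, 0)" for j
      using carrier[OF that(1)] C'(1)[of j] n_pos
      by (subst mult_smult_assoc_mat[of _ n n _ n]) auto
    then show ?thesis by (simp add: \<phi>_def sum_distrib_left)
  qed
  have homog_right: "\<phi> (Z * Y) = \<phi> Z * \<phi> Y" if Z: "Z \<in> A" and Y: "Y \<in> A" "homog \<zeta> Y" and "\<zeta> ^ n = 1" for Z Y \<zeta>
  proof -
    obtain k where k: "\<zeta> = \<omega> ^ k" using root_of_unity_obtain \<open>\<zeta> ^ n = 1\<close> by blast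
    have CY: "Y \<in> carrier_mat n n" and CZ: "Z \<in> carrier_mat n n" using Y Z carrier by auto
    show ?thesis
    proof (cases "unit_degree \<zeta>")
      case True
      then obtain q where q: "k = s * q" using dvd k by blast
      \<comment> \<open>\<open>W ^\<^sub>m q\<close> has the degree inverse to that of
        \<open>Y\<close>, so the product is a scalar and \<open>Y\<close> is a multiple of
        \<open>X ^\<^sub>m q\<close>.\<close>
      have "homog 1 (Y * W ^\<^sub>m q)"
        using homog_mult[OF CY C'(2) Y(2) homog_pow[OF C(2) X(7)], of q]
        by (simp add: k q power_mult power_inverse)
      then obtain y where y: "Y * W ^\<^sub>m q = y \<cdot>\<^sub>m 1\<^sub>m n"
        using homog_one_scalar mult[OF Y(1) pow_mem[OF X(2)]] by blast
      have "Y = Y * W ^\<^sub>m q * X ^\<^sub>m q"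
        using CY C' pow_mat_inverse[OF C(2,1) X(4), of q] by (simp add: assoc_mult_mat[of _ n n _ n _ n])
      also have "\<dots> = y \<cdot>\<^sub>m X ^\<^sub>m q"
        using y left_mult_one_mat[OF C'(1), of q] C'(1)[of q] by (simp add: mult_smult_assoc_mat[of _ n n _ n])
      finally have Yq: "Y = y \<cdot>\<^sub>m X ^\<^sub>m q" .
      have *: "\<phi> (V * Y) = y * \<phi> V" if V: "V \<in> A" for V
      proof -
        have CV: "V \<in> carrier_mat n n" using V carrier by auto
        have "V * Y = y \<cdot>\<^sub>m (V * X ^\<^sub>m q)"
          unfolding Yq using CV C' by (simp add: mult_smult_distrib[of _ n n _ n])
        then have "\<phi> (V * Y) = y * \<phi> (V * X ^\<^sub>m q)"
          using smult' mult pow_mem V X by simp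
        \<comment> \<open>Multiplication by \<open>X ^\<^sub>m q\<close> shifts the powers of
          \<open>X\<close> cyclically, which leaves the sum over all of them unchanged.\<close>
        also have "\<phi> (V * X ^\<^sub>m q) = (\<Sum>j<d. (V * X ^\<^sub>m (q + j)) $$ (0, 0))"
          unfolding \<phi>_def using CV C C' by (simp add: pow_mat_add assoc_mult_mat[of _ n n _ n _ n])
        also have "\<dots> = \<phi> V"
          unfolding \<phi>_def using C C' X
          by (intro sum_shift_periodic[of "\<lambda>j. (V * X ^\<^sub>m j) $$ (0, 0)"]) (simp add: pow_mat_add[OF C(1)])
        finally show ?thesis .
      qed
      \<comment> \<open>The case \<open>V = 1\<^sub>m n\<close> identifies \<open>y\<close> as
        \<open>\<phi> Y\<close>.\<close>
      show ?thesis
        using *[OF Z] *[OF one] one' CY by simp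
    next
      case False
      have *: "\<phi> (V * Y) = 0" if "V \<in> A" for V
        using that
      proof (induction V rule: homog_induct)
        case (homog \<eta> V)
        have CV: "V \<in> carrier_mat n n" using homog carrier by auto
        have "(V * Y * X ^\<^sub>m j) $$ (0, 0) = 0" for j
        proof (rule ccontr)
          assume nz: "(V * Y * X ^\<^sub>m j) $$ (0, 0) \<noteq> 0"
          have YX: "homog (\<zeta> * (\<omega> ^ s) ^ j) (Y * X ^\<^sub>m j)" "Y * X ^\<^sub>m j \<in> A"
            using homog_mult[OF CY C'(1) Y(2) homog_pow[OF C(1) X(6)]] mult Y pow_mem X by auto
          have eq: "V * Y * X ^\<^sub>m j = V * (Y * X ^\<^sub>m j)"
            using CV CY C' by (simp add: assoc_mult_mat[of _ n n _ n _ n])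
          \<comment> \<open>A nonzero diagonal entry occurs only in degree 1.\<close>
          have 1: "\<eta> * (\<zeta> * (\<omega> ^ s) ^ j) = 1"
            using nz homog_mult[OF CV carrier[OF YX(2)] homog(3) YX(1)] homog_diag_zero unfolding eq by blast
          then have "unit_degree \<eta>"
            using unit_degreeI[OF homog(1,3) YX(2,1)] nz unfolding eq by blast
          moreover have nonzero: "\<eta> \<noteq> 0" "(\<omega> ^ s) ^ j \<noteq> 0"
            using 1 by auto
          moreover have "\<zeta> = inverse \<eta> * inverse ((\<omega> ^ s) ^ j)"
            using 1 nonzero by (simp add: field_simps)
          ultimately show False
            using False unit unit_degree_mult unit_degree_inverse unit_degree_pow by metis
        qed
        then show ?case by (simp add: \<phi>_def)
      next
        case (add V V')
        then show ?case
          using CY carrier add' mult[OF _ Y(1)] by (simp add: add_mult_distrib_mat[of _ n n _ _ n])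
      qed
      show ?thesis
        using *[OF Z] *[OF one] CY by simp
    qed
  qed
  have "\<phi> (Z * Y) = \<phi> Z * \<phi> Y" if "Z \<in> A" "Y \<in> A" for Z Y
    using that(2)
  proof (induction Y rule: homog_induct)
    case (homog \<zeta> Y)
    then show ?case using homog_right that(1) by blast
  next
    case (add Y Y')
    then show ?case
      using that(1) carrier add' mult[OF that(1)]
      by (simp add: mult_add_distrib_mat[of _ n n _ n] distrib_left)
  qed
  with one' add' smult' that show thesis by blast
qed

text \<open>Conjugation \<open>X \<mapsto> diag(a)^(-k) X diag(a)^k\<close>, the matrix form of the
  action of \<open>t^k\<close>.\<close>

definition twist_pow :: "nat \<Rightarrow> complex mat \<Rightarrow> complex mat" where
  "twist_pow k X = Matrix.mat n n (\<lambda>(i, j). (a j / a i) ^ k * X $$ (i, j))"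

lemma twist_pow_mem: "X \<in> A \<Longrightarrow> twist_pow k X \<in> A"
proof (induction k)
  case 0
  have "twist_pow 0 X = X"
    unfolding twist_pow_def using carrier[OF 0] by (intro eq_matI) auto
  then show ?case using 0 by simp
next
  case (Suc k)
  have "twist_pow (Suc k) X = Matrix.mat n n (\<lambda>(i, j). a j / a i * twist_pow k X $$ (i, j))"
    unfolding twist_pow_def by (intro eq_matI) auto
  then show ?case using twist Suc by simp
qed

text \<open>Both sides are additive, so homogeneous matrices suffice. In degree \<zeta> the twists
  multiply by powers of \<zeta>, which add up to 0 for \<zeta> \<noteq> 1, when the diagonal
  vanishes too. In degree 1 the matrix is a scalar and both sides are \<open>n\<close> times
  it.\<close>

lemma sum_character_twist_pow:
  assumes c1: "\<phi> (1\<^sub>m n) = 1"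
    and cadd: "\<And>Y Z. Y \<in> A \<Longrightarrow> Z \<in> A \<Longrightarrow> \<phi> (Y + Z) = \<phi> Y + \<phi> Z"
    and csmult: "\<And>c Y. Y \<in> A \<Longrightarrow> \<phi> (c \<cdot>\<^sub>m Y) = c * \<phi> Y"
    and X: "X \<in> A"
  shows "(\<Sum>k<n. \<phi> (twist_pow k X)) = (\<Sum>i<n. X $$ (i, i))"
  using X
proof (induction X rule: homog_induct)
  case (homog \<zeta> Y)
  have C: "Y \<in> carrier_mat n n" using carrier homog by auto
  have "twist_pow k Y = \<zeta> ^ k \<cdot>\<^sub>m Y" for k
  proof (rule eq_matI)
    fix i j assume "i < dim_row (\<zeta> ^ k \<cdot>\<^sub>m Y)" "j < dim_col (\<zeta> ^ k \<cdot>\<^sub>m Y)"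
    then have ij: "i < n" "j < n" using C by auto
    then have "Y $$ (i, j) \<noteq> 0 \<Longrightarrow> a j / a i = \<zeta>"
      using homog(3) a_nz[OF ij(1)] by (auto simp: homog_def)
    then show "twist_pow k Y $$ (i, j) = (\<zeta> ^ k \<cdot>\<^sub>m Y) $$ (i, j)"
      using ij C by (cases "Y $$ (i, j) = 0") (auto simp: twist_pow_def)
  qed (use C in \<open>auto simp: twist_pow_def\<close>)
  then have eq: "(\<Sum>k<n. \<phi> (twist_pow k Y)) = (\<Sum>k<n. \<zeta> ^ k) * \<phi> Y"
    using csmult[OF homog(1)] by (simp add: sum_distrib_right)
  have tr: "(\<Sum>i<n. Y $$ (i, i)) = n * Y $$ (0, 0)"
  proof -
    have "(\<Sum>i<n. Y $$ (i, i)) = (\<Sum>i<n. Y $$ (0, 0))"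
      by (intro sum.cong) (auto intro: diag[OF homog(1)])
    then show ?thesis by simp
  qed
  show ?case
  proof (cases "\<zeta> = 1")
    case True
    then have "\<phi> Y = \<phi> (Y $$ (0, 0) \<cdot>\<^sub>m 1\<^sub>m n)"
      using homog_one_scalar[OF homog(1)] homog(3) by metis
    then show ?thesis
      using True eq tr csmult[OF one] c1 by simp
  next
    case False
    then have "(\<Sum>k<n. \<zeta> ^ k) = 0"
      using homog(2) by (simp add: geometric_sum)
    then show ?thesis
      using eq tr homog_diag_zero[OF homog(3) False] by simp
  qed
next
  case (add Y Z)
  have "twist_pow k (Y + Z) = twist_pow k Y + twist_pow k Z" for k
    unfolding twist_pow_def using carrier[OF add(1)] carrier[OF add(2)]
    by (intro eq_matI) (auto simp: distrib_left)
  then have "(\<Sum>k<n. \<phi> (twist_pow k (Y + Z))) = (\<Sum>k<n. \<phi> (twist_pow k Y)) + (\<Sum>k<n. \<phi> (twist_pow k Z))"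
    using cadd twist_pow_mem add(1,2) by (simp add: sum.distrib)
  then show ?case
    using add carrier[OF add(1)] carrier[OF add(2)] by (simp add: sum.distrib)
qed

end

section \<open>Monomial matrices\<close>

lemma group_SL: "group (SL n)"
proof (rule groupI)
  show "\<exists>B\<in>carrier (SL n). B \<otimes>\<^bsub>SL n\<^esub> A = \<one>\<^bsub>SL n\<^esub>" if "A \<in> carrier (SL n)" for A
  proof -
    have A: "A \<in> carrier_mat n n" "Determinant.det A = 1" using that by (auto simp: SL_def)
    then obtain B where B: "B \<in> carrier_mat n n" "B * A = 1\<^sub>m n"
      using det_non_zero_imp_unit[OF A(1), of n] by (auto simp: Units_def ring_mat_def)
    then have "Determinant.det B = 1"
      using det_mult[OF B(1) A(1)] A by simp
    then show ?thesis using B by (auto simp: SL_def)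
  qed
qed (auto simp: SL_def det_mult assoc_mult_mat[of _ n n _ n _ n])

text \<open>The \<open>j\<close>-th power of \<open>cyclic_perm_mat n z\<close>, in closed form for all integers \<open>j\<close>.\<close>

definition monomial_mat :: "nat \<Rightarrow> complex \<Rightarrow> int \<Rightarrow> complex mat" where
  "monomial_mat n z j = Matrix.mat n n (\<lambda>(p, q). if int p = (int q + j) mod int n then z powi j else 0)"

lemma monomial_mat_carrier [simp]: "monomial_mat n z j \<in> carrier_mat n n"
  by (simp add: monomial_mat_def)

lemma monomial_mat_add:
  assumes "z \<noteq> 0"
  shows "monomial_mat n z i * monomial_mat n z j = monomial_mat n z (i + j)"
proof (rule eq_matI)
  fix p q assume "p < dim_row (monomial_mat n z (i + j))" "q < dim_col (monomial_mat n z (i + j))"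
  then have pq: "p < n" "q < n" by (auto simp: monomial_mat_def)
  \<comment> \<open>\<open>l\<close> is the row of the only nonzero entry in column \<open>q\<close>
    of the right factor.\<close>
  define l where "l = nat ((int q + j) mod int n)"
  have l: "l < n" "int l = (int q + j) mod int n"
    using pq by (auto simp: l_def nat_less_iff)
  have "(monomial_mat n z i * monomial_mat n z j) $$ (p, q) =
      (\<Sum>k<n. monomial_mat n z i $$ (p, k) * monomial_mat n z j $$ (k, q))"
    using pq by (simp add: monomial_mat_def scalar_prod_def atLeast0LessThan)
  also have "\<dots> = (\<Sum>k<n. if k = l then monomial_mat n z i $$ (p, l) * z powi j else 0)"
  proof (rule sum.cong)
    fix k assume "k \<in> {..<n}"
    moreover have "int k = (int q + j) mod int n \<longleftrightarrow> k = l"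
      using l(2) by linarith
    ultimately have "monomial_mat n z j $$ (k, q) = (if k = l then z powi j else 0)"
      using pq(2) by (simp add: monomial_mat_def)
    then show "monomial_mat n z i $$ (p, k) * monomial_mat n z j $$ (k, q) =
        (if k = l then monomial_mat n z i $$ (p, l) * z powi j else 0)" by simp
  qed simp
  also have "\<dots> = monomial_mat n z i $$ (p, l) * z powi j"
    using l by simp
  also have "\<dots> = monomial_mat n z (i + j) $$ (p, q)"
  proof -
    have "(int l + i) mod int n = (int q + (i + j)) mod int n"
      unfolding l(2) by (simp add: mod_add_left_eq flip: add.assoc) (simp add: ac_simps)
    then show ?thesis
      using pq l(1) assms by (simp add: monomial_mat_def power_int_add)
  qed
  finally show "(monomial_mat n z i * monomial_mat n z j) $$ (p, q) = monomial_mat n z (i + j) $$ (p, q)" .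
qed (auto simp: monomial_mat_def)

lemma monomial_mat_0: "monomial_mat n z 0 = 1\<^sub>m n"
  by (rule eq_matI) (auto simp: monomial_mat_def)

lemma monomial_mat_1: "monomial_mat n z 1 = cyclic_perm_mat n z"
proof (rule eq_matI)
  fix i j assume "i < dim_row (cyclic_perm_mat n z)" "j < dim_col (cyclic_perm_mat n z)"
  then have ij: "i < n" "j < n" by (auto simp: cyclic_perm_mat_def)
  have "int i = (int j + 1) mod int n \<longleftrightarrow> i = (j + 1) mod n"
    by (metis of_nat_1 of_nat_add of_nat_eq_iff of_nat_mod)
  then show "monomial_mat n z 1 $$ (i, j) = cyclic_perm_mat n z $$ (i, j)"
    using ij by (simp add: monomial_mat_def cyclic_perm_mat_def)
qed (auto simp: monomial_mat_def cyclic_perm_mat_def)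

text \<open>Expansion along row 0: only the entry in the last column can be nonzero, and deleting
  its row and column leaves \<open>z\<close> times the identity.\<close>

lemma det_cyclic_perm_mat:
  assumes "0 < n"
  shows "Determinant.det (cyclic_perm_mat n z) = (-1) ^ (n + 1) * z ^ n"
proof -
  obtain k where k: "n = Suc k" using assms by (cases n) auto
  let ?C = "cyclic_perm_mat n z"
  have C: "?C \<in> carrier_mat n n" by (simp add: cyclic_perm_mat_def)
  have m: "mat_delete ?C 0 k = z \<cdot>\<^sub>m 1\<^sub>m k"
    by (rule eq_matI) (auto simp: mat_delete_def cyclic_perm_mat_def k)
  have "Determinant.det ?C = (\<Sum>j<n. ?C $$ (0, j) * cofactor ?C 0 j)"
    using laplace_expansion_row[OF C assms] .
  also have "\<dots> = (\<Sum>j<n. if j = k then z * cofactor ?C 0 k else 0)"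
    by (intro sum.cong) (auto simp: cyclic_perm_mat_def k)
  also have "\<dots> = z * cofactor ?C 0 k"
    by (simp add: k)
  also have "\<dots> = (-1) ^ (n + 1) * z ^ n"
    using m by (simp add: cofactor_def k det_smult)
  finally show ?thesis .
qed

lemma root_of_sign_nonzero: "0 < n \<Longrightarrow> z ^ n = (-1) ^ (n + 1) \<Longrightarrow> z \<noteq> (0 :: complex)"
  by (auto simp: power_0_left)

text \<open>Additivity in \<open>j\<close> reduces this to \<open>j = 1\<close>, where the condition
  on \<open>z\<close> cancels the sign of the \<open>n\<close>-cycle.\<close>

lemma det_monomial_mat:
  assumes n: "0 < n" and z: "z ^ n = (-1) ^ (n + 1)"
  shows "Determinant.det (monomial_mat n z j) = 1"
proof -
  note nz = root_of_sign_nonzero[OF assms]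
  have m: "Determinant.det (monomial_mat n z (i + j)) = Determinant.det (monomial_mat n z i) * Determinant.det (monomial_mat n z j)" for i j
    by (simp add: det_mult[of _ n] flip: monomial_mat_add[OF nz])
  have 1: "Determinant.det (monomial_mat n z 1) = 1"
    using det_cyclic_perm_mat[OF n, of z] z by (simp add: monomial_mat_1 flip: power_mult_distrib)
  have nat: "Determinant.det (monomial_mat n z (int k)) = 1" for k
  proof (induction k)
    case (Suc k)
    then show ?case using m[of "int k" 1] 1 by (simp add: add.commute)
  qed (simp add: monomial_mat_0)
  show ?thesis
  proof (cases "0 \<le> j")
    case True
    then show ?thesis using nat[of "nat j"] by simp
  next
    case False
    then show ?thesis using nat[of "nat (- j)"] m[of j "- j"] by (simp add: monomial_mat_0)
  qed
qed

text \<open>Homomorphisms from the integers are determined by their value at 1.\<close>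

lemma cyclic_perm_mat_int_pow:
  assumes n: "0 < n" and z: "z ^ n = (-1) ^ (n + 1)"
  shows "cyclic_perm_mat n z [^]\<^bsub>SL n\<^esub> (j :: int) = monomial_mat n z j"
proof -
  have "monomial_mat n z \<in> hom integer_group (SL n)"
    using det_monomial_mat[OF assms] monomial_mat_add[OF root_of_sign_nonzero[OF assms]]
    by (intro homI) (simp_all add: SL_def)
  then have "monomial_mat n z (1 [^]\<^bsub>integer_group\<^esub> j) = monomial_mat n z 1 [^]\<^bsub>SL n\<^esub> j"
    by (intro hom_int_pow) (auto simp: group_SL)
  then show ?thesis by (simp add: monomial_mat_1)
qed

text \<open>Moving a diagonal matrix past a cyclic shift rotates its entries. Through this the
  action of \<open>t^j\<close> enters the product formula for \<open>induced_rep\<close>.\<close>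

lemma mat_diag_monomial_mat:
  "mat_diag n d * monomial_mat n z j = monomial_mat n z j * mat_diag n (\<lambda>i. d (nat ((int i + j) mod int n)))"
proof -
  have "d p * monomial_mat n z j $$ (p, q) = monomial_mat n z j $$ (p, q) * d (nat ((int q + j) mod int n))"
    if "p < n" "q < n" for p q
  proof (cases "int p = (int q + j) mod int n")
    case True
    then have "nat ((int q + j) mod int n) = p" by (metis nat_int)
    then show ?thesis by simp
  qed (use that in \<open>simp add: monomial_mat_def\<close>)
  then show ?thesis
    unfolding mat_diag_mult_left[OF monomial_mat_carrier] mat_diag_mult_right[OF monomial_mat_carrier]
    by (intro eq_matI) auto
qed

text \<open>A cyclic shift by \<open>j\<close> fixes an index only if \<open>n\<close> divides
  \<open>j\<close>, and then it fixes all of them.\<close>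

lemma mat_trace_monomial_mat_diag:
  "mat_trace (monomial_mat n z j * mat_diag n d) = (if int n dvd j then z powi j * (\<Sum>i<n. d i) else 0)"
proof -
  have "int p = (int p + j) mod int n \<longleftrightarrow> int n dvd j" if "p < n" for p
  proof -
    have "int p = (int p + j) mod int n \<longleftrightarrow> int p mod int n = (int p + j) mod int n"
      using that by simp
    also have "\<dots> \<longleftrightarrow> int n dvd j"
      by (simp add: mod_eq_dvd_iff)
    finally show ?thesis .
  qed
  then have "mat_trace (monomial_mat n z j * mat_diag n d) = (\<Sum>p<n. if int n dvd j then z powi j * d p else 0)"
    by (subst mat_diag_mult_right[of _ n n], simp) (auto simp: mat_trace_def monomial_mat_def intro!: sum.cong)
  then show ?thesis by (simp add: sum_distrib_left)
qed

text \<open>The \<open>a i\<close> are all the roots of \<open>X^n - c\<close>, so the constant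
  terms of this polynomial and of the product of linear factors agree.\<close>

lemma prod_distinct_nth_roots:
  fixes a :: "nat \<Rightarrow> 'a::idom"
  assumes n: "0 < n" and inj: "inj_on a {..<n}" and pow: "\<And>i. i < n \<Longrightarrow> a i ^ n = c"
  shows "(\<Prod>i<n. a i) = (-1) ^ (n + 1) * c"
proof -
  let ?p = "\<Prod>i<n. [:- a i, 1:]"
  let ?q = "monom 1 n - [:c:]"
  have deg: "degree ?p = n"
    by (subst degree_prod_eq_sum_degree) auto
  have lc: "lead_coeff ?p = 1"
    by (simp add: lead_coeff_prod)
  have "?p = ?q"
  proof (rule poly_eqI_degree_lead_coeff[where A = "a ` {..<n}" and n = n])
    show "coeff ?p n = coeff ?q n"
      using lc deg n by (simp add: coeff_pCons split: nat.splits)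
    show "n \<le> card (a ` {..<n})" using inj by (simp add: card_image)
    show "degree ?p \<le> n" using deg by simp
    show "degree ?q \<le> n"
      by (intro degree_diff_le) (auto simp: degree_monom_le)
    show "poly ?p x = poly ?q x" if "x \<in> a ` {..<n}" for x
      using that pow by (auto simp: poly_prod poly_monom prod_zero_iff)
  qed
  then have "poly ?p 0 = - c"
    using n by (simp add: poly_monom)
  moreover have "poly ?p 0 = (-1) ^ n * (\<Prod>i<n. a i)"
    by (simp add: poly_prod prod_uminus)
  ultimately have "(-1) ^ n * (\<Prod>i<n. a i) = - c" by simp
  then have "(-1) ^ n * ((-1) ^ n * (\<Prod>i<n. a i)) = (-1) ^ (n + 1) * c" by simp
  then show ?thesis by (simp flip: mult.assoc power_add)
qed

section \<open>Groups with infinite cyclic abelianization\<close>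

lemma comm_group_complex_units: "comm_group complex_units"
  by (rule comm_groupI) (auto simp: complex_units_def intro: exI[of _ "inverse _"] bexI[of _ "inverse _"])

lemma (in group) hom_derived_trivial:
  assumes H: "comm_group H" and h: "h \<in> hom G H" and g: "g \<in> derived G (carrier G)"
  shows "h g = \<one>\<^bsub>H\<^esub>"
proof -
  interpret H: comm_group H by fact
  interpret h: group_hom G H h
    using h by unfold_locales
  have "h ` derived G (carrier G) = derived H (h ` carrier G)"
    by (rule h.derived_img[symmetric]) simp
  also have "\<dots> = {\<one>\<^bsub>H\<^esub>}"
    by (rule H.derived_eq_singleton) (use h.hom_closed in auto)
  finally show ?thesis using g by auto
qed

lemma periodic_int_mod:
  fixes f :: "int \<Rightarrow> 'a"
  assumes "\<And>x. f (x + p) = f x"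
  shows "f (x mod p) = f x"
proof -
  have nat: "f (x + int k * p) = f x" for x k
  proof (induction k)
    case (Suc k)
    then show ?case using assms[of "x + int k * p"] by (simp add: algebra_simps)
  qed simp
  show ?thesis
  proof (cases "0 \<le> x div p")
    case True
    then show ?thesis
      using nat[of "x mod p" "nat (x div p)"] by simp
  next
    case False
    have "x + (- (x div p)) * p = x mod p"
      using div_mult_mod_eq[of x p] by linarith
    then show ?thesis
      using False nat[of x "nat (- (x div p))"] by simp
  qed
qed

text \<open>The form in which a knot group enters: \<open>m\<close> plays the meridian, and it
  splits the abelianization map onto the integers.\<close>

locale infinite_cyclic_abelianization = group G for G (structure) +
  fixes \<epsilon> :: "'a \<Rightarrow> int" and m :: 'a
  assumes abelianization: "abelianization G integer_group \<epsilon>"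
    and m_closed' [simp]: "m \<in> carrier G" and \<epsilon>_m [simp]: "\<epsilon> m = 1"
begin

abbreviation "D \<equiv> derived G (carrier G)"

text \<open>A lift to \<open>G\<close> of the action of \<open>t\<^sup>k\<close>.\<close>

definition t_conj :: "int \<Rightarrow> 'a \<Rightarrow> 'a" where
  "t_conj k g = m [^] (- k) \<otimes> g \<otimes> m [^] k"

abbreviation cls :: "'a \<Rightarrow> 'a set" where
  "cls g \<equiv> derived G D #> g"

section \<open>The abelianization map and the commutator subgroup\<close>

lemma \<epsilon>_hom: "\<epsilon> \<in> hom G integer_group"
  using abelianization by (simp add: abelianization_def)

lemma \<epsilon>_mult [simp]: "g \<in> carrier G \<Longrightarrow> h \<in> carrier G \<Longrightarrow> \<epsilon> (g \<otimes> h) = \<epsilon> g + \<epsilon> h"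
  using hom_mult[OF \<epsilon>_hom] by simp

lemma \<epsilon>_int_pow [simp]: "\<epsilon> (m [^] (k :: int)) = k"
  using hom_int_pow[OF \<epsilon>_hom m_closed' is_group group_integer_group, of k] by simp

lemma \<epsilon>_nat_pow [simp]: "\<epsilon> (m [^] (k :: nat)) = int k"
  using \<epsilon>_int_pow[of "int k"] by (simp add: int_pow_int del: \<epsilon>_int_pow)

lemma \<epsilon>_inv [simp]: "g \<in> carrier G \<Longrightarrow> \<epsilon> (inv g) = - \<epsilon> g"
  using \<epsilon>_mult[of g "inv g"] \<epsilon>_int_pow[of 0] by (simp del: \<epsilon>_int_pow)

lemma mem_D_iff: "g \<in> D \<longleftrightarrow> g \<in> carrier G \<and> \<epsilon> g = 0"
  using abelianization by (auto simp: abelianization_def kernel_def)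

lemma D_closed [simp]: "g \<in> D \<Longrightarrow> g \<in> carrier G"
  by (simp add: mem_D_iff)

lemma subgroup_D: "subgroup D G"
  by (rule derived_is_subgroup) simp

lemma normal_derived_D: "derived G D \<lhd> G"
  by (rule derived_is_normal[OF derived_self_is_normal])

lemma D_mult [simp]: "g \<in> D \<Longrightarrow> h \<in> D \<Longrightarrow> g \<otimes> h \<in> D"
  by (simp add: mem_D_iff)

lemma D_one [simp]: "\<one> \<in> D"
  by (rule subgroup.one_closed[OF subgroup_D])

lemma D_inv [simp]: "g \<in> D \<Longrightarrow> inv g \<in> D"
  by (simp add: mem_D_iff)

lemma t_conj_closed [simp]: "g \<in> carrier G \<Longrightarrow> t_conj k g \<in> carrier G"
  by (simp add: t_conj_def)

lemma t_conj_D [simp]: "g \<in> D \<Longrightarrow> t_conj k g \<in> D"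
  by (simp add: mem_D_iff t_conj_def del: D_closed)

lemma t_conj_mult: "g \<in> carrier G \<Longrightarrow> h \<in> carrier G \<Longrightarrow> t_conj k (g \<otimes> h) = t_conj k g \<otimes> t_conj k h"
  by (simp add: t_conj_def int_pow_neg m_assoc inv_solve_left' flip: m_assoc) (simp add: m_assoc)

lemma t_conj_add: "g \<in> carrier G \<Longrightarrow> t_conj (j + k) g = t_conj j (t_conj k g)"
  using int_pow_mult[of m "- j" "- k"] int_pow_mult[of m k j]
  by (simp add: t_conj_def m_assoc add.commute)

lemma t_conj_0: "g \<in> carrier G \<Longrightarrow> t_conj 0 g = g"
  by (simp add: t_conj_def)

section \<open>The Alexander module and the action of \<open>t\<close>\<close>

lemma group_D: "group (G\<lparr>carrier := D\<rparr>)"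
  by (rule subgroup_imp_group[OF subgroup_D])

lemma alexander_module_eq: "alexander_module G = (G\<lparr>carrier := D\<rparr>) Mod derived G D"
  by (simp add: alexander_module_def Let_def)

lemma derived_consistent_D: "derived (G\<lparr>carrier := D\<rparr>) D = derived G D"
  using derived_consistent[OF _ subgroup_D] by simp

lemma comm_group_alexander_module: "comm_group (alexander_module G)"
  using group.derived_quot_is_comm_group[OF group_D] by (simp add: alexander_module_eq derived_consistent_D)

lemma normal_derived_in_D: "derived G D \<lhd> G\<lparr>carrier := D\<rparr>"
  by (rule derived_subgroup_is_normal[OF subgroup_D])

lemma r_coset_D: "derived G D #>\<^bsub>G\<lparr>carrier := D\<rparr>\<^esub> g = cls g"
  by (simp add: r_coset_def)

lemma carrier_alexander_module: "carrier (alexander_module G) = cls ` D"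
  by (simp add: alexander_module_eq carrier_FactGroup r_coset_D)

lemma cls_mult:
  assumes "g \<in> D" "h \<in> D"
  shows "cls g \<otimes>\<^bsub>alexander_module G\<^esub> cls h = cls (g \<otimes> h)"
  using normal.rcos_sum[OF normal_derived_D] assms
  by (simp add: alexander_module_eq FactGroup_def set_mult_def)

lemma cls_hom: "cls \<in> hom (G\<lparr>carrier := D\<rparr>) (alexander_module G)"
  by (rule homI) (auto simp: carrier_alexander_module cls_mult)

lemma cls_inv:
  assumes "g \<in> D"
  shows "inv\<^bsub>alexander_module G\<^esub> cls g = cls (inv g)"
proof -
  interpret H: comm_group "alexander_module G" by (rule comm_group_alexander_module)
  have "\<one>\<^bsub>alexander_module G\<^esub> = cls \<one>"
    using hom_one[OF cls_hom group_D] H.is_group by simp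
  then show ?thesis
    using assms by (intro H.inv_equality) (auto simp: cls_mult carrier_alexander_module)
qed

text \<open>The second derived group is normal in the whole of \<open>G\<close>, so conjugation by
  powers of \<open>m\<close> carries its cosets to cosets.\<close>

lemma t_act_cls:
  assumes "g \<in> D"
  shows "t_act G m k (cls g) = cls (t_conj k g)"
proof -
  interpret N: normal "derived G D" G by (rule normal_derived_D)
  have g: "g \<in> carrier G" using assms by simp
  have "t_act G m k (cls g) = t_conj k ` cls g"
    by (simp add: t_act_def t_conj_def)
  also have "\<dots> = cls (t_conj k g)"
  proof (intro equalityI subsetI)
    fix y assume "y \<in> t_conj k ` cls g"
    then obtain d where d: "d \<in> derived G D" "y = t_conj k (d \<otimes> g)"
      by (auto simp: r_coset_def)
    then have "t_conj k d \<in> derived G D"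
      using N.inv_op_closed1[of "m [^] k" d] by (simp add: t_conj_def int_pow_neg)
    then show "y \<in> cls (t_conj k g)"
      using d g N.mem_carrier by (auto simp: r_coset_def t_conj_mult)
  next
    fix y assume "y \<in> cls (t_conj k g)"
    then obtain d where d: "d \<in> derived G D" "y = d \<otimes> t_conj k g"
      by (auto simp: r_coset_def)
    then have "t_conj (- k) d \<in> derived G D"
      using N.inv_op_closed2[of "m [^] k" d] by (simp add: t_conj_def int_pow_neg)
    moreover have "y = t_conj k (t_conj (- k) d \<otimes> g)"
      using d g N.mem_carrier by (simp add: t_conj_mult t_conj_0 flip: t_conj_add)
    ultimately show "y \<in> t_conj k ` cls g"
      by (auto simp: r_coset_def)
  qed
  finally show ?thesis .
qed

section \<open>Characters of the Alexander module\<close>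

lemma carrier_complex_units: "carrier complex_units = {c. c \<noteq> 0}"
  and mult_complex_units: "x \<otimes>\<^bsub>complex_units\<^esub> y = x * y"
  and one_complex_units: "\<one>\<^bsub>complex_units\<^esub> = 1"
  by (auto simp: complex_units_def)

text \<open>The characters of \<open>H / (t\<^sup>n - 1)\<close>, as functions on the commutator subgroup.\<close>

definition periodic_character :: "nat \<Rightarrow> ('a \<Rightarrow> complex) \<Rightarrow> bool" where
  "periodic_character n f \<longleftrightarrow> f \<in> hom (G\<lparr>carrier := D\<rparr>) complex_units \<and> (\<forall>h\<in>D. f (t_conj (int n) h) = f h)"

lemma t_power_minus_one_eq:
  "t_power_minus_one G m n = (\<lambda>h. cls (t_conj (int n) h \<otimes> inv h)) ` D"
  unfolding t_power_minus_one_def carrier_alexander_module image_image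
  by (intro image_cong) (auto simp: t_act_cls cls_inv cls_mult)

text \<open>It is the image of the endomorphism \<open>t^n - 1\<close>, which is a homomorphism
  because the module is commutative.\<close>

lemma normal_t_power_minus_one: "t_power_minus_one G m n \<lhd> alexander_module G"
proof -
  interpret H: comm_group "alexander_module G" by (rule comm_group_alexander_module)
  let ?t = "\<lambda>h. t_act G m (int n) h \<otimes>\<^bsub>alexander_module G\<^esub> inv\<^bsub>alexander_module G\<^esub> h"
  have t: "t_act G m (int n) \<in> hom (alexander_module G) (alexander_module G)"
    by (rule homI) (auto simp: carrier_alexander_module t_act_cls cls_mult t_conj_mult)
  have "?t \<in> hom (alexander_module G) (alexander_module G)"
  proof (rule homI)
    fix x y assume xy: "x \<in> carrier (alexander_module G)" "y \<in> carrier (alexander_module G)"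
    then show "?t (x \<otimes>\<^bsub>alexander_module G\<^esub> y) = ?t x \<otimes>\<^bsub>alexander_module G\<^esub> ?t y"
      using hom_mult[OF t xy] hom_in_carrier[OF t] by (simp add: H.inv_mult H.m_ac)
  qed (use hom_in_carrier[OF t] in auto)
  then interpret t: group_hom "alexander_module G" "alexander_module G" ?t
    by unfold_locales
  have "subgroup (t_power_minus_one G m n) (alexander_module G)"
    using t.img_is_subgroup by (simp add: t_power_minus_one_def)
  then show ?thesis by (rule H.subgroup_imp_normal)
qed

lemma periodic_character_of_quotient:
  assumes chi: "chi \<in> hom (alexander_module G) complex_units"
    and "factors_through_quotient (alexander_module G) (t_power_minus_one G m n) complex_units chi"
  shows "periodic_character n (\<lambda>h. chi (cls h))"
  unfolding periodic_character_def
proof (intro conjI ballI)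
  let ?H = "alexander_module G" and ?B = "t_power_minus_one G m n"
  interpret H: comm_group ?H by (rule comm_group_alexander_module)
  interpret B: normal ?B ?H by (rule normal_t_power_minus_one)
  obtain \<psi> where \<psi>: "\<psi> \<in> hom (?H Mod ?B) complex_units" "\<And>h. h \<in> carrier ?H \<Longrightarrow> chi h = \<psi> (?B #>\<^bsub>?H\<^esub> h)"
    using assms(2) by (auto simp: factors_through_quotient_def)
  show hom: "(\<lambda>h. chi (cls h)) \<in> hom (G\<lparr>carrier := D\<rparr>) complex_units"
    using Group.hom_compose[OF cls_hom chi] by (simp add: comp_def)
  fix h assume h: "h \<in> D"
  let ?b = "t_conj (int n) h \<otimes> inv h"
  \<comment> \<open>\<open>cls ?b\<close> is \<open>t^n h - h\<close> in multiplicative notation; it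
    lies in the trivial coset of \<open>?B\<close>, so \<open>chi\<close> is 1 on it.\<close>
  have "cls ?b \<in> ?B" using h by (auto simp: t_power_minus_one_eq)
  then have "?B #>\<^bsub>?H\<^esub> cls ?b = ?B #>\<^bsub>?H\<^esub> \<one>\<^bsub>?H\<^esub>"
    by (metis B.is_subgroup B.subset H.coset_join2 H.coset_mult_one B.mem_carrier)
  then have "chi (cls ?b) = chi \<one>\<^bsub>?H\<^esub>"
    using \<psi>(2)[OF H.one_closed] \<psi>(2)[of "cls ?b"] h by (simp add: carrier_alexander_module)
  also have "\<dots> = 1"
    using hom_one[OF chi H.is_group comm_group.axioms(2)[OF comm_group_complex_units]]
    by (simp add: one_complex_units)
  finally have "chi (cls ?b) * chi (cls h) = chi (cls h)" by simp
  then have "chi (cls (?b \<otimes> h)) = chi (cls h)"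
    using hom_mult[OF hom, of ?b h] h by (simp add: mult_complex_units)
  moreover have "?b \<otimes> h = t_conj (int n) h"
    using h by (simp add: m_assoc)
  ultimately show "chi (cls (t_conj (int n) h)) = chi (cls h)" by simp
qed

text \<open>Two factorizations in turn: \<open>f\<close> descends along \<open>cls\<close> because a
  homomorphism to an abelian group kills commutators, and the resulting \<open>chi\<close> descends
  to the quotient by \<open>(t^n - 1) H\<close> because \<open>f\<close> is periodic.\<close>

lemma quotient_of_periodic_character:
  assumes f: "periodic_character n f"
  obtains chi where "chi \<in> hom (alexander_module G) complex_units" "\<And>h. h \<in> D \<Longrightarrow> chi (cls h) = f h"
    "factors_through_quotient (alexander_module G) (t_power_minus_one G m n) complex_units chi"
proof -
  let ?GD = "G\<lparr>carrier := D\<rparr>" and ?H = "alexander_module G" and ?B = "t_power_minus_one G m n"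
  interpret H: comm_group ?H by (rule comm_group_alexander_module)
  interpret C: comm_group complex_units by (rule comm_group_complex_units)
  have fh: "f \<in> hom ?GD complex_units" and fn: "\<And>h. h \<in> D \<Longrightarrow> f (t_conj (int n) h) = f h"
    using f by (auto simp: periodic_character_def)
  have fm: "f (x \<otimes> y) = f x * f y" if "x \<in> D" "y \<in> D" for x y
    using hom_mult[OF fh, of x y] that by (simp add: mult_complex_units)
  obtain chi where chi: "chi \<in> hom (?GD Mod derived G D) complex_units"
    "\<And>h. h \<in> carrier ?GD \<Longrightarrow> chi (derived G D #>\<^bsub>?GD\<^esub> h) = f h"
  proof (rule FactGroup_universal[OF fh normal_derived_in_D])
    fix x y assume "x \<in> carrier ?GD" "y \<in> carrier ?GD" "derived G D #>\<^bsub>?GD\<^esub> x = derived G D #>\<^bsub>?GD\<^esub> y"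
    then have xy: "x \<in> D" "y \<in> D" "cls x = cls y" by (auto simp: r_coset_D)
    have "x \<in> cls y"
      using xy rcos_self[of x "derived G D"] normal_imp_subgroup[OF normal_derived_D] by simp
    then obtain d where d: "d \<in> derived G D" "x = d \<otimes> y"
      by (auto simp: r_coset_def)
    have "d \<in> D"
      using d(1) derived_incl[OF order_refl subgroup_D] by auto
    moreover have "f d = 1"
      using group.hom_derived_trivial[OF group_D comm_group_complex_units fh, of d] d(1)
      by (simp add: derived_consistent_D one_complex_units)
    ultimately show "f x = f y"
      using d(2) xy fm by simp
  qed blast
  then have chi': "chi \<in> hom ?H complex_units" "\<And>h. h \<in> D \<Longrightarrow> chi (cls h) = f h"
    by (auto simp: alexander_module_eq r_coset_D)
  obtain \<psi> where "\<psi> \<in> hom (?H Mod ?B) complex_units" "\<And>h. h \<in> carrier ?H \<Longrightarrow> \<psi> (?B #>\<^bsub>?H\<^esub> h) = chi h"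
  proof (rule FactGroup_universal[OF chi'(1) normal_t_power_minus_one])
    fix x y assume xy: "x \<in> carrier ?H" "y \<in> carrier ?H" "?B #>\<^bsub>?H\<^esub> x = ?B #>\<^bsub>?H\<^esub> y"
    have "x \<in> ?B #>\<^bsub>?H\<^esub> y"
      using xy H.rcos_self[of x ?B] normal_imp_subgroup[OF normal_t_power_minus_one] by simp
    then obtain h where h: "h \<in> D" "x = cls (t_conj (int n) h \<otimes> inv h) \<otimes>\<^bsub>?H\<^esub> y"
      by (auto simp: r_coset_def t_power_minus_one_eq)
    have "f (t_conj (int n) h \<otimes> inv h) = f h * f (inv h)"
      using h fm fn by simp
    also have "\<dots> = f \<one>"
      using h fm[of h "inv h"] by simp
    also have "\<dots> = 1"
      using hom_one[OF fh group_D C.is_group] by (simp add: one_complex_units)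
    finally show "chi x = chi y"
      using hom_mult[OF chi'(1), of "cls (t_conj (int n) h \<otimes> inv h)" y] h xy chi'(2)
      by (simp add: carrier_alexander_module mult_complex_units)
  qed blast
  then have "factors_through_quotient ?H ?B complex_units chi"
    unfolding factors_through_quotient_def by metis
  then show thesis using that chi' by blast
qed

section \<open>Induced representations and fixed characters\<close>

text \<open>\<open>\<alpha>\<^sub>(\<^sub>n\<^sub>,\<^sub>\<chi>\<^sub>)\<close> as a function on \<open>G\<close>, with \<open>f\<close> the composition of \<open>\<chi>\<close> and the projection onto \<open>H\<close>.\<close>

definition induced_rep :: "nat \<Rightarrow> complex \<Rightarrow> ('a \<Rightarrow> complex) \<Rightarrow> 'a \<Rightarrow> complex mat" where
  "induced_rep n z f g = monomial_mat n z (\<epsilon> g) * mat_diag n (\<lambda>i. f (t_conj (int i) (m [^] (- \<epsilon> g) \<otimes> g)))"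

lemma m_pow_mult_D: "g \<in> carrier G \<Longrightarrow> m [^] (- \<epsilon> g) \<otimes> g \<in> D"
  by (simp add: mem_D_iff del: D_closed)

lemma induced_rep_carrier [simp]: "induced_rep n z f g \<in> carrier_mat n n"
  by (simp add: induced_rep_def mult_carrier_mat[of _ n n])

lemma metabelian_rep_projection:
  assumes n: "0 < n" and z: "z ^ n = (-1) ^ (n + 1)" and f: "\<And>h. h \<in> D \<Longrightarrow> chi (cls h) = f h" and g: "g \<in> carrier G"
  shows "(metabelian_rep G m n z chi \<circ> metabelian_projection G m \<epsilon>) g = induced_rep n z f g"
  using m_pow_mult_D[OF g] f
  by (simp add: metabelian_rep_def metabelian_projection_def induced_rep_def cyclic_perm_mat_int_pow[OF n z] t_act_cls)

lemma periodic_character_mult: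
  "periodic_character n f \<Longrightarrow> g \<in> D \<Longrightarrow> h \<in> D \<Longrightarrow> f (g \<otimes> h) = f g * f h"
  unfolding periodic_character_def by (auto dest: hom_mult[of f _ _ g h] simp: mult_complex_units)

lemma periodic_character_one:
  assumes "periodic_character n f"
  shows "f \<one> = 1"
  using hom_one[of f "G\<lparr>carrier := D\<rparr>" complex_units] assms group_D comm_group.axioms(2)[OF comm_group_complex_units]
  by (simp add: periodic_character_def one_complex_units)

lemma periodic_character_conj_mod:
  assumes f: "periodic_character n f" and h: "h \<in> D"
  shows "f (t_conj (k mod int n) h) = f (t_conj k h)"
proof (rule periodic_int_mod)
  fix x
  have "t_conj (x + int n) h = t_conj (int n) (t_conj x h)"
    using h by (simp add: add.commute flip: t_conj_add)
  then show "f (t_conj (x + int n) h) = f (t_conj x h)"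
    using f h by (simp add: periodic_character_def)
qed

text \<open>With \<open>a\<close> and \<open>b\<close> the parts of \<open>g\<close> and
  \<open>h\<close> in \<open>D\<close>, this reflects the rule
  \<open>(i, a) (j, b) = (i + j, t^j a + b)\<close>; the factor \<open>t^j\<close> arises when the
  diagonal matrix of \<open>a\<close> passes the monomial matrix of \<open>h\<close>.\<close>

lemma induced_rep_mult:
  assumes f: "periodic_character n f" and z: "z \<noteq> 0" and g: "g \<in> carrier G" and h: "h \<in> carrier G"
  shows "induced_rep n z f (g \<otimes> h) = induced_rep n z f g * induced_rep n z f h"
proof -
  define a b where "a = m [^] (- \<epsilon> g) \<otimes> g" and "b = m [^] (- \<epsilon> h) \<otimes> h"
  have ab: "a \<in> D" "b \<in> D" using m_pow_mult_D g h by (auto simp: a_def b_def)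
  let ?Q = "monomial_mat n z"
  let ?d = "\<lambda>c. mat_diag n (\<lambda>i. f (t_conj (int i) c))"
  have "m [^] (- \<epsilon> (g \<otimes> h)) \<otimes> (g \<otimes> h) = m [^] (- \<epsilon> h) \<otimes> m [^] (- \<epsilon> g) \<otimes> (g \<otimes> h)"
    using g h int_pow_mult[of m "- \<epsilon> h" "- \<epsilon> g"] by (simp add: add.commute[of "\<epsilon> g"])
  also have "\<dots> = t_conj (\<epsilon> h) a \<otimes> b"
    using g h by (simp add: t_conj_def a_def b_def m_assoc int_pow_neg inv_solve_left')
      (simp add: m_assoc[symmetric])
  finally have e: "m [^] (- \<epsilon> (g \<otimes> h)) \<otimes> (g \<otimes> h) = t_conj (\<epsilon> h) a \<otimes> b" .
  \<comment> \<open>Periodicity of \<open>f\<close> allows exponents of \<open>t\<close> to be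
    reduced modulo \<open>n\<close>. For \<open>n = 0\<close> the matrices are empty.\<close>
  have "mat_diag n (\<lambda>i. f (t_conj (int (nat ((int i + \<epsilon> h) mod int n))) a)) * ?d b = ?d (t_conj (\<epsilon> h) a \<otimes> b)"
  proof (cases "n = 0")
    case False
    then have "f (t_conj (int (nat ((int i + \<epsilon> h) mod int n))) a) = f (t_conj (int i) (t_conj (\<epsilon> h) a))" for i
      using ab periodic_character_conj_mod[OF f ab(1), of "int i + \<epsilon> h"] by (simp flip: t_conj_add)
    then show ?thesis
      using ab by (simp add: t_conj_mult periodic_character_mult[OF f])
  qed (auto simp: mat_diag_def)
  then have "induced_rep n z f (g \<otimes> h) =
      ?Q (\<epsilon> g) * ?Q (\<epsilon> h) * (mat_diag n (\<lambda>i. f (t_conj (int (nat ((int i + \<epsilon> h) mod int n))) a)) * ?d b)"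
    unfolding induced_rep_def e using g h by (simp add: monomial_mat_add[OF z])
  also have "\<dots> = ?Q (\<epsilon> g) * (?Q (\<epsilon> h) * mat_diag n (\<lambda>i. f (t_conj (int (nat ((int i + \<epsilon> h) mod int n))) a))) * ?d b"
    by (simp add: assoc_mult_mat[of _ n n _ n _ n] mult_carrier_mat[of _ n n] del: mat_diag_diag)
  also have "\<dots> = ?Q (\<epsilon> g) * (?d a * ?Q (\<epsilon> h)) * ?d b"
    by (simp add: mat_diag_monomial_mat)
  also have "\<dots> = induced_rep n z f g * induced_rep n z f h"
    by (simp add: induced_rep_def a_def b_def assoc_mult_mat[of _ n n _ n _ n] mult_carrier_mat[of _ n n])
  finally show ?thesis .
qed

lemma induced_rep_hom:
  assumes n: "0 < n" and z: "z ^ n = (-1) ^ (n + 1)" and f: "periodic_character n f"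
  shows "induced_rep n z f \<in> hom G (SL n)"
proof -
  note mult = induced_rep_mult[OF f root_of_sign_nonzero[OF n z]]
  let ?\<delta> = "\<lambda>g. Determinant.det (induced_rep n z f g)"
  have \<delta>_mult: "?\<delta> (g \<otimes> h) = ?\<delta> g * ?\<delta> h" if "g \<in> carrier G" "h \<in> carrier G" for g h
    using mult[OF that] by (simp add: det_mult[of _ n])
  have one: "induced_rep n z f \<one> = 1\<^sub>m n"
    using periodic_character_one[OF f] D_one by (simp add: induced_rep_def mem_D_iff t_conj_def int_pow_neg monomial_mat_0)
  have "?\<delta> \<in> hom G complex_units"
  proof (rule homI)
    fix g assume "g \<in> carrier G"
    then have "?\<delta> g * ?\<delta> (inv g) = 1"
      using \<delta>_mult[of g "inv g"] one by simp
    then show "?\<delta> g \<in> carrier complex_units" by (auto simp: carrier_complex_units)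
  qed (simp add: \<delta>_mult mult_complex_units)
  then have D: "?\<delta> h = 1" if "h \<in> D" for h
    using hom_derived_trivial[OF comm_group_complex_units _ that] by (simp add: one_complex_units)
  have "?\<delta> g = 1" if g: "g \<in> carrier G" for g
  proof -
    \<comment> \<open>The diagonal factor is itself a value of the representation, at an element of
      \<open>D\<close>, so its determinant is 1.\<close>
    have "mat_diag n (\<lambda>i. f (t_conj (int i) (m [^] (- \<epsilon> g) \<otimes> g))) = induced_rep n z f (m [^] (- \<epsilon> g) \<otimes> g)"
      using m_pow_mult_D[OF g] by (simp add: induced_rep_def mem_D_iff monomial_mat_0 left_mult_one_mat[OF mat_diag_dim])
    then have "Determinant.det (mat_diag n (\<lambda>i. f (t_conj (int i) (m [^] (- \<epsilon> g) \<otimes> g)))) = 1"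
      using D m_pow_mult_D[OF g] by simp
    then show ?thesis
      by (simp add: induced_rep_def det_mult[of _ n] det_monomial_mat[OF n z])
  qed
  then show ?thesis
    using mult by (intro homI) (auto simp: SL_def)
qed

lemma trace_induced_rep:
  "mat_trace (induced_rep n z f g) =
    (if int n dvd \<epsilon> g then z powi \<epsilon> g * (\<Sum>i<n. f (t_conj (int i) (m [^] (- \<epsilon> g) \<otimes> g))) else 0)"
  by (simp add: induced_rep_def mat_trace_monomial_mat_diag)

text \<open>The generator multiplies the trace at \<open>g\<close> by a root of unity that is 1
  exactly if \<open>n\<close> divides \<open>\<epsilon> g\<close>.\<close>

lemma character_fixed_points_iff:
  assumes n: "0 < n" and \<alpha>: "\<alpha> \<in> hom G (SL n)"
  shows "rep_character G \<alpha> \<in> character_fixed_points G n \<epsilon> \<longleftrightarrow>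
    (\<forall>g\<in>carrier G. \<not> int n dvd \<epsilon> g \<longrightarrow> mat_trace (\<alpha> g) = 0)"
proof -
  have act: "character_act G n \<epsilon> k (rep_character G \<alpha>) g = cis (2 * pi / n) powi (k * \<epsilon> g) * mat_trace (\<alpha> g)"
    if "g \<in> carrier G" for k g
    unfolding character_act_rep_character[OF \<alpha>] rep_character_rep_act[OF \<alpha> that]
    using that by (simp add: rep_character_def)
  have out: "character_act G n \<epsilon> k (rep_character G \<alpha>) g = rep_character G \<alpha> g" if "g \<notin> carrier G" for k g
    unfolding character_act_rep_character[OF \<alpha>] using that by (simp add: rep_character_def)
  show ?thesis
  proof
    assume fixed: "rep_character G \<alpha> \<in> character_fixed_points G n \<epsilon>"
    show "\<forall>g\<in>carrier G. \<not> int n dvd \<epsilon> g \<longrightarrow> mat_trace (\<alpha> g) = 0"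
    proof (intro ballI impI)
      fix g assume g: "g \<in> carrier G" "\<not> int n dvd \<epsilon> g"
      \<comment> \<open>For \<open>n = 1\<close> the element 1 is not in the carrier of
        \<open>integer_mod_group n\<close>, but then \<open>n\<close> divides everything.\<close>
      then have "n \<noteq> 1" by auto
      then have "1 \<in> carrier (integer_mod_group n)" by simp
      then have "character_act G n \<epsilon> 1 (rep_character G \<alpha>) g = rep_character G \<alpha> g"
        using fixed by (simp add: character_fixed_points_def)
      then have "cis (2 * pi / n) powi \<epsilon> g * mat_trace (\<alpha> g) = mat_trace (\<alpha> g)"
        using act[OF g(1), of 1] g(1) by (simp add: rep_character_def)
      then show "mat_trace (\<alpha> g) = 0"
        using cis_powi_eq_one_iff[OF n, of "\<epsilon> g"] g(2) by simp
    qed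
  next
    assume tr: "\<forall>g\<in>carrier G. \<not> int n dvd \<epsilon> g \<longrightarrow> mat_trace (\<alpha> g) = 0"
    have "character_act G n \<epsilon> k (rep_character G \<alpha>) g = rep_character G \<alpha> g" for k g
    proof (cases "g \<in> carrier G \<and> int n dvd \<epsilon> g")
      case True
      then have "cis (2 * pi / n) powi (k * \<epsilon> g) = 1"
        using cis_powi_eq_one_iff[OF n] by simp
      then show ?thesis using True act by (simp add: rep_character_def)
    next
      case False
      then show ?thesis using tr act out by (cases "g \<in> carrier G") (auto simp: rep_character_def)
    qed
    then show "rep_character G \<alpha> \<in> character_fixed_points G n \<epsilon>"
      using \<alpha> by (auto simp: character_fixed_points_def character_variety_def)
  qed
qed

text \<open>The results determine the character of \<alpha>: \<open>f\<close> gives it on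
  \<open>D\<close>, the scaling by \<open>m [^] (int n)\<close> on all \<open>g\<close> with
  \<open>n\<close> dividing \<open>\<epsilon> g\<close>, and elsewhere it vanishes by
  \<open>tr\<close>.\<close>

lemma fixed_rep_character_data:
  assumes n: "0 < n" and \<alpha>: "\<alpha> \<in> hom G (SL n)"
    and tr: "\<And>g. g \<in> carrier G \<Longrightarrow> \<not> int n dvd \<epsilon> g \<Longrightarrow> mat_trace (\<alpha> g) = 0"
  obtains f where "periodic_character n f"
    "\<And>h. h \<in> D \<Longrightarrow> mat_trace (\<alpha> h) = (\<Sum>i<n. f (t_conj (int i) h))"
    "\<And>g. g \<in> carrier G \<Longrightarrow> mat_trace (\<alpha> (m [^] (int n) \<otimes> g)) = (-1) ^ (n + 1) * mat_trace (\<alpha> g)"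
proof -
  have \<alpha>C: "\<alpha> g \<in> carrier_mat n n" and \<alpha>det: "Determinant.det (\<alpha> g) = 1" if "g \<in> carrier G" for g
    using \<alpha> that by (auto simp: hom_def SL_def)
  have \<alpha>mult: "\<alpha> (g \<otimes> h) = \<alpha> g * \<alpha> h" if "g \<in> carrier G" "h \<in> carrier G" for g h
    using hom_mult[OF \<alpha> that] by (simp add: SL_def)
  have \<alpha>one: "\<alpha> \<one> = 1\<^sub>m n"
    using hom_one[OF \<alpha> is_group group_SL] by (simp add: SL_def)
  have \<alpha>pow: "\<alpha> (g [^] k) = \<alpha> g ^\<^sub>m k" if "g \<in> carrier G" for g and k :: nat
    using that by (induction k) (use \<alpha>C in \<open>auto simp: \<alpha>one \<alpha>mult\<close>)
  have tr_pow: "mat_trace (\<alpha> m ^\<^sub>m k) = 0" if "0 < k" "k < n" for k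
  proof -
    have "\<not> n dvd k" using that by (auto dest: dvd_imp_le)
    then show ?thesis using tr[of "m [^] k"] by (simp add: \<alpha>pow)
  qed
  obtain a P Q where wit: "similar_mat_wit (\<alpha> m) (mat_diag n a) P Q" and a: "inj_on a {..<n}"
    "\<And>i. i < n \<Longrightarrow> a i \<noteq> 0" "\<And>k. 0 < k \<Longrightarrow> k < n \<Longrightarrow> (\<Sum>i<n. a i ^ k) = 0"
    using traceless_powers_imp_diagonalizable[OF \<alpha>C[OF m_closed'] _ tr_pow] \<alpha>det[OF m_closed'] by auto
  note PQ = similar_mat_witD2[OF \<alpha>C[OF m_closed'] wit]
  \<comment> \<open>\<open>\<beta>\<close> is \<alpha> written in an eigenbasis of
    \<open>\<alpha> m\<close>.\<close>
  define \<beta> where "\<beta> g = Q * \<alpha> g * P" for g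
  have \<beta>C [simp]: "\<beta> g \<in> carrier_mat n n" if "g \<in> carrier G" for g
    using \<alpha>C[OF that] PQ by (simp add: \<beta>_def)
  have \<beta>mult: "\<beta> (g \<otimes> h) = \<beta> g * \<beta> h" if "g \<in> carrier G" "h \<in> carrier G" for g h
  proof -
    note C = \<alpha>C[OF that(1)] \<alpha>C[OF that(2)] PQ(6,7)
    have "\<beta> g * \<beta> h = Q * \<alpha> g * (P * (Q * \<alpha> h * P))"
      unfolding \<beta>_def by (rule assoc_mult_mat[of _ n n _ n _ n]) (use C in auto)
    also have "P * (Q * \<alpha> h * P) = P * Q * (\<alpha> h * P)"
      using C by (simp add: assoc_mult_mat[of _ n n _ n _ n])
    also have "\<dots> = \<alpha> h * P"
      using C PQ(1) by simp
    also have "Q * \<alpha> g * (\<alpha> h * P) = \<beta> (g \<otimes> h)"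
      unfolding \<beta>_def \<alpha>mult[OF that] using C by (simp add: assoc_mult_mat[of _ n n _ n _ n])
    finally show ?thesis ..
  qed
  have \<beta>one: "\<beta> \<one> = 1\<^sub>m n"
    using PQ by (simp add: \<beta>_def \<alpha>one)
  have \<beta>tr: "mat_trace (\<beta> g) = mat_trace (\<alpha> g)" if "g \<in> carrier G" for g
    unfolding \<beta>_def using mat_trace_conj[of Q n P "\<alpha> g"] PQ \<alpha>C[OF that] by simp
  have \<beta>m: "\<beta> m = mat_diag n a"
    unfolding \<beta>_def using similar_mat_witD2(3)[OF PQ(5) similar_mat_wit_sym[OF wit]] by simp
  have \<beta>pow: "\<beta> (m [^] k) = mat_diag n (\<lambda>i. a i ^ k)" for k :: nat
    by (induction k) (auto simp: \<beta>one \<beta>mult \<beta>m mult.commute)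
  \<comment> \<open>The exponent of \<open>g \<otimes> m [^] k\<close> is not divisible by
    \<open>n\<close>, and its vanishing trace is a power sum weighted by the diagonal of
    \<open>\<beta> g\<close>.\<close>
  have wps: "(\<Sum>i<n. \<beta> g $$ (i, i) * a i ^ k) = 0" if "g \<in> carrier G" "int n dvd \<epsilon> g" "0 < k" "k < n" for g k
  proof -
    have "\<not> int n dvd \<epsilon> (g \<otimes> m [^] k)"
    proof -
      have "\<not> n dvd k" using that by (auto dest: dvd_imp_le)
      then show ?thesis using that by (simp add: dvd_add_right_iff)
    qed
    then have "mat_trace (\<beta> (g \<otimes> m [^] k)) = 0"
      using that tr by (simp add: \<beta>tr)
    moreover have "mat_trace (\<beta> (g \<otimes> m [^] k)) = (\<Sum>i<n. \<beta> g $$ (i, i) * a i ^ k)"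
      using that by (simp add: \<beta>mult \<beta>pow mat_diag_mult_right[OF \<beta>C] mat_trace_def)
    ultimately show ?thesis by simp
  qed
  have const: "\<beta> g $$ (i, i) = \<beta> g $$ (0, 0)" if "g \<in> carrier G" "int n dvd \<epsilon> g" "i < n" for g i
    by (rule weighted_power_sums_zero_imp_const[where a = a and n = n and x = "\<lambda>i. \<beta> g $$ (i, i)"])
      (fact a(3), rule wps[OF that(1,2)], use a(2) that(3) in auto)
  \<comment> \<open>\<open>const\<close> applies to \<open>m [^] n\<close> as well, whose matrix is
    diagonal with entries \<open>a i ^ n\<close>.\<close>
  have apow: "a i ^ n = a 0 ^ n" if "i < n" for i
    using const[of "m [^] n" i] that n by (simp add: \<beta>pow mat_diag_def)
  \<comment> \<open>The \<open>a i\<close> are all the \<open>n\<close>-th roots of one number,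
    which their product, the determinant 1, pins down.\<close>
  have c: "a 0 ^ n = (-1) ^ (n + 1)"
  proof -
    have "Determinant.det (mat_diag n a) = 1"
      using det_similar[of "\<alpha> m" "mat_diag n a"] wit \<alpha>det[OF m_closed'] by (auto simp: similar_mat_def)
    moreover have "Determinant.det (mat_diag n a) = (\<Prod>i<n. a i)"
      by (subst det_upper_triangular[of _ n]) (auto simp: mat_diag_def prod_list_diag_prod atLeast0LessThan)
    ultimately have "(-1) ^ (n + 1) * a 0 ^ n = 1"
      using prod_distinct_nth_roots[OF n a(1) apow] by simp
    then have "(-1) ^ (n + 1) * ((-1) ^ (n + 1) * a 0 ^ n) = (-1) ^ (n + 1)" by simp
    then show ?thesis by (simp flip: mult.assoc power_add)
  qed
  let ?N = "\<beta> ` D"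
  let ?A = "mat_span ?N"
  let ?tw = "\<lambda>X. Matrix.mat n n (\<lambda>(i, j). a j / a i * X $$ (i, j))"
  have N: "?N \<subseteq> carrier_mat n n" by auto
  have Nmult: "X * Y \<in> ?N" if "X \<in> ?N" "Y \<in> ?N" for X Y
    using that by (auto simp flip: \<beta>mult)
  have AC: "X \<in> carrier_mat n n" if "X \<in> ?A" for X
    using mat_span_carrier[OF that N] .
  have \<beta>conj: "\<beta> (t_conj 1 h) = ?tw (\<beta> h)" if "h \<in> carrier G" for h
  proof -
    \<comment> \<open>Entries are compared in this relation, in which \<open>\<beta> m\<close> is
      diagonal.\<close>
    have "m \<otimes> t_conj 1 h = h \<otimes> m"
      using that by (simp add: t_conj_def int_pow_neg m_assoc[symmetric])
    then have e: "mat_diag n a * \<beta> (t_conj 1 h) = \<beta> h * mat_diag n a"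
      using that \<beta>mult[of m "t_conj 1 h"] \<beta>mult[of h m] by (simp add: \<beta>m)
    show ?thesis
    proof (rule eq_matI)
      fix i j assume "i < dim_row (?tw (\<beta> h))" "j < dim_col (?tw (\<beta> h))"
      then have ij: "i < n" "j < n" by auto
      have "a i * \<beta> (t_conj 1 h) $$ (i, j) = \<beta> h $$ (i, j) * a j"
        using arg_cong[OF e, of "\<lambda>X. X $$ (i, j)"] ij that
        by (simp add: mat_diag_mult_right[OF \<beta>C] mat_diag_mult_left[OF \<beta>C])
      then show "\<beta> (t_conj 1 h) $$ (i, j) = ?tw (\<beta> h) $$ (i, j)"
        using ij a(2)[OF ij(1)] by (simp add: field_simps)
    qed (use carrier_matD[OF \<beta>C[OF t_conj_closed[OF that]]] in auto)
  qed
  \<comment> \<open>Conjugation by \<open>m\<close> preserves \<open>D\<close>, which gives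
    stability under \<open>?tw\<close>; \<open>const\<close> gives the diagonal. Both pass from
    \<open>?N\<close> to linear combinations.\<close>
  have A: "graded_mat_algebra n a ?A"
  proof
    show "0 < n" "inj_on a {..<n}" using n a by auto
    show "1\<^sub>m n \<in> ?A" using mat_span.base[OF imageI[OF D_one, of \<beta>]] by (simp add: \<beta>one)
    show "a i \<noteq> 0" if "i < n" for i by (rule a(2)[OF that])
    show "a i ^ n = a 0 ^ n" if "i < n" for i by (rule apow[OF that])
    fix X assume X: "X \<in> ?A"
    show "X \<in> carrier_mat n n" using AC X .
    show "c \<cdot>\<^sub>m X \<in> ?A" for c using mat_span.smult X .
    show "X + Y \<in> ?A" "X * Y \<in> ?A" if "Y \<in> ?A" for Y
      using mat_span.add mat_span_mult[OF N Nmult] X that by auto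
    show "?tw X \<in> ?A"
      using X
    proof (induction X rule: mat_span.induct)
      case (base X)
      then obtain h where h: "h \<in> D" "X = \<beta> h" by auto
      then have "?tw X = \<beta> (t_conj 1 h)"
        using \<beta>conj[of h] by simp
      then show ?case
        using mat_span.base[OF imageI[OF t_conj_D[OF h(1)], of \<beta>]] by simp
    next
      case (add X Y)
      have "?tw (X + Y) = ?tw X + ?tw Y"
        using AC[OF add(1)] AC[OF add(2)] by (intro eq_matI) (auto simp: distrib_left add_divide_distrib)
      then show ?case using mat_span.add[OF add(3,4)] by simp
    next
      case (smult X c)
      have "?tw (c \<cdot>\<^sub>m X) = c \<cdot>\<^sub>m ?tw X"
        using AC[OF smult(1)] by (intro eq_matI) auto
      then show ?case using mat_span.smult[OF smult(2)] by simp
    qed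
    fix i assume i: "i < n"
    show "X $$ (i, i) = X $$ (0, 0)"
      using X
    proof (induction X rule: mat_span.induct)
      case (base X)
      then obtain h where h: "h \<in> D" "X = \<beta> h" by auto
      then have "int n dvd \<epsilon> h" by (simp add: mem_D_iff del: D_closed)
      then show ?case unfolding h(2) using const D_closed[OF h(1)] i by blast
    next
      case (add X Y)
      then show ?case using i n AC[OF add(1)] AC[OF add(2)] by simp
    next
      case (smult X c)
      then show ?case using i n AC[OF smult(1)] by simp
    qed
  qed
  interpret A: graded_mat_algebra n a ?A by (rule A)
  obtain \<phi> where \<phi>: "\<phi> (1\<^sub>m n) = 1" "\<And>Y Z. Y \<in> ?A \<Longrightarrow> Z \<in> ?A \<Longrightarrow> \<phi> (Y + Z) = \<phi> Y + \<phi> Z"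
    "\<And>c Y. Y \<in> ?A \<Longrightarrow> \<phi> (c \<cdot>\<^sub>m Y) = c * \<phi> Y" "\<And>Y Z. Y \<in> ?A \<Longrightarrow> Z \<in> ?A \<Longrightarrow> \<phi> (Y * Z) = \<phi> Y * \<phi> Z"
    using A.obtain_character by blast
  define f where "f h = \<phi> (\<beta> h)" for h
  have mem: "\<beta> h \<in> ?A" if "h \<in> D" for h using that by (auto intro: mat_span.base)
  have tw: "\<beta> (t_conj (int k) h) = A.twist_pow k (\<beta> h)" if "h \<in> D" for k h
  proof (induction k)
    case 0
    then show ?case
      using that by (intro eq_matI) (auto simp: t_conj_0 A.twist_pow_def carrier_matD[OF \<beta>C])
  next
    case (Suc k)
    have "t_conj (int (Suc k)) h = t_conj 1 (t_conj (int k) h)"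
      using that by (simp flip: t_conj_add)
    then show ?case
      using Suc that \<beta>conj[of "t_conj (int k) h"] by (auto simp: A.twist_pow_def intro!: eq_matI)
  qed
  have f_mult: "f (g \<otimes> h) = f g * f h" if "g \<in> D" "h \<in> D" for g h
    using that \<phi>(4) mem by (simp add: f_def \<beta>mult)
  have "f \<in> hom (G\<lparr>carrier := D\<rparr>) complex_units"
  proof (rule homI)
    fix g assume "g \<in> carrier (G\<lparr>carrier := D\<rparr>)"
    then have "g \<in> D" by simp
    \<comment> \<open>Values of \<open>f\<close> are nonzero because the inverse of \<open>g\<close>
      lies in \<open>D\<close> too and \<open>f \<one> = 1\<close>.\<close>
    then have "f g * f (inv g) = f \<one>"
      using f_mult[of g "inv g"] by simp
    then show "f g \<in> carrier complex_units"
      using \<phi>(1) by (auto simp: carrier_complex_units f_def \<beta>one)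
  qed (simp add: f_mult mult_complex_units)
  \<comment> \<open>The \<open>n\<close>-fold twist is trivial, all ratios \<open>a j / a i\<close>
    being \<open>n\<close>-th roots of unity.\<close>
  moreover have "f (t_conj (int n) h) = f h" if "h \<in> D" for h
  proof -
    have "A.twist_pow n (\<beta> h) = \<beta> h"
      using A.ratio_pow that by (intro eq_matI) (auto simp: A.twist_pow_def carrier_matD[OF \<beta>C])
    then show ?thesis using tw that by (simp add: f_def)
  qed
  ultimately have "periodic_character n f" by (simp add: periodic_character_def)
  moreover have "mat_trace (\<alpha> h) = (\<Sum>i<n. f (t_conj (int i) h))" if "h \<in> D" for h
    using A.sum_character_twist_pow[OF \<phi>(1-3) mem[OF that]] that \<beta>tr[of h]
    by (simp add: f_def tw mat_trace_def carrier_matD[OF \<beta>C])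
  moreover have "mat_trace (\<alpha> (m [^] (int n) \<otimes> g)) = (-1) ^ (n + 1) * mat_trace (\<alpha> g)" if "g \<in> carrier G" for g
  proof -
    \<comment> \<open>By \<open>apow\<close> the diagonal entries all agree, so
      \<open>m [^] n\<close> acts as a scalar.\<close>
    have "\<beta> (m [^] n) = a 0 ^ n \<cdot>\<^sub>m 1\<^sub>m n"
    proof (rule eq_matI)
      fix i j assume "i < dim_row (a 0 ^ n \<cdot>\<^sub>m 1\<^sub>m n)" "j < dim_col (a 0 ^ n \<cdot>\<^sub>m 1\<^sub>m n)"
      then show "\<beta> (m [^] n) $$ (i, j) = (a 0 ^ n \<cdot>\<^sub>m 1\<^sub>m n) $$ (i, j)"
        using apow[of i] by (cases "i = j") (auto simp: \<beta>pow mat_diag_def)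
    qed (simp_all add: \<beta>pow mat_diag_def)
    then have "\<beta> (m [^] n \<otimes> g) = a 0 ^ n \<cdot>\<^sub>m \<beta> g"
      using that by (simp add: \<beta>mult mult_smult_assoc_mat[of _ n n _ n] left_mult_one_mat[OF \<beta>C])
    then show ?thesis
      using that c \<beta>tr[of "m [^] n \<otimes> g"] \<beta>tr[of g] by (simp add: int_pow_int mat_trace_smult[OF \<beta>C])
  qed
  ultimately show thesis by (rule that)
qed

text \<open>If \<open>n\<close> divides \<open>\<epsilon> g\<close>, then \<open>g\<close> is
  \<open>m^(nq) h\<close> with \<open>h\<close> in \<open>D\<close>, and both traces are
  \<open>z^(nq)\<close> times their value at \<open>h\<close>. At all other \<open>g\<close> both
  vanish.\<close>

lemma fixed_rep_character_eq:
  assumes n: "0 < n" and z: "z ^ n = (-1) ^ (n + 1)" and \<alpha>: "\<alpha> \<in> hom G (SL n)"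
    and tr: "\<And>g. g \<in> carrier G \<Longrightarrow> \<not> int n dvd \<epsilon> g \<Longrightarrow> mat_trace (\<alpha> g) = 0"
  obtains f where "periodic_character n f" "\<And>g. g \<in> carrier G \<Longrightarrow> mat_trace (\<alpha> g) = mat_trace (induced_rep n z f g)"
proof -
  obtain f where f: "periodic_character n f"
    and D: "\<And>h. h \<in> D \<Longrightarrow> mat_trace (\<alpha> h) = (\<Sum>i<n. f (t_conj (int i) h))"
    and shift: "\<And>g. g \<in> carrier G \<Longrightarrow> mat_trace (\<alpha> (m [^] (int n) \<otimes> g)) = (-1) ^ (n + 1) * mat_trace (\<alpha> g)"
    using fixed_rep_character_data[OF n \<alpha> tr] by blast
  note z0 = root_of_sign_nonzero[OF n z]
  have nat: "mat_trace (\<alpha> (m [^] (int n * int k) \<otimes> g)) = z ^ (n * k) * mat_trace (\<alpha> g)" if "g \<in> carrier G" for k g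
  proof (induction k)
    case (Suc k)
    have "m [^] (int n * int (Suc k)) \<otimes> g = m [^] (int n) \<otimes> (m [^] (int n * int k) \<otimes> g)"
      using that int_pow_mult[of m "int n" "int n * int k"] by (simp add: m_assoc distrib_left)
    then show ?case
      using that shift[of "m [^] (int n * int k) \<otimes> g"] Suc z by (simp add: power_add)
  qed (use that in simp)
  have int: "mat_trace (\<alpha> (m [^] (int n * q) \<otimes> g)) = z powi (int n * q) * mat_trace (\<alpha> g)" if g: "g \<in> carrier G" for q g
  proof (cases "0 \<le> q")
    case True
    then obtain k where "q = int k" using nonneg_int_cases by blast
    then show ?thesis using nat[OF g, of k] by (simp flip: power_int_of_nat)
  next
    case False
    define k where "k = nat (- q)"
    have q: "q = - int k" using False by (simp add: k_def)
    \<comment> \<open>A negative shift is undone by a positive one, to which \<open>nat\<close>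
      applies.\<close>
    have "m [^] (int n * int k) \<otimes> (m [^] (int n * q) \<otimes> g) = g"
      using g by (simp add: q int_pow_neg flip: m_assoc)
    then have "mat_trace (\<alpha> g) = z ^ (n * k) * mat_trace (\<alpha> (m [^] (int n * q) \<otimes> g))"
      using nat[of "m [^] (int n * q) \<otimes> g" k] g by simp
    moreover have "z powi (int n * q) = inverse (z ^ (n * k))"
      by (simp add: q power_int_minus flip: power_int_of_nat)
    ultimately show ?thesis using z0 by simp
  qed
  have "mat_trace (\<alpha> g) = mat_trace (induced_rep n z f g)" if g: "g \<in> carrier G" for g
  proof (cases "int n dvd \<epsilon> g")
    case True
    then obtain q where q: "\<epsilon> g = int n * q" by blast
    let ?h = "m [^] (- \<epsilon> g) \<otimes> g"
    have "m [^] (int n * q) \<otimes> ?h = g"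
      using g by (simp add: q int_pow_neg flip: m_assoc)
    then have "mat_trace (\<alpha> g) = z powi \<epsilon> g * mat_trace (\<alpha> ?h)"
      using int[of ?h q] g by (simp add: q)
    then show ?thesis
      using D[OF m_pow_mult_D[OF g]] True by (simp add: trace_induced_rep)
  qed (simp add: tr[OF g] trace_induced_rep)
  with f show thesis by (rule that)
qed

section \<open>The fixed point set\<close>

theorem character_fixed_points_eq:
  assumes n: "0 < n" and z: "z ^ n = (-1) ^ (n + 1)"
  shows "character_fixed_points G n \<epsilon> =
    {rep_character G (metabelian_rep G m n z chi \<circ> metabelian_projection G m \<epsilon>) |chi.
       chi \<in> hom (alexander_module G) complex_units \<and>
       factors_through_quotient (alexander_module G) (t_power_minus_one G m n) complex_units chi}"
    (is "_ = {?\<xi> chi |chi. ?P chi}")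
proof (intro equalityI subsetI)
  \<comment> \<open>The two representations agree on the carrier, to which
    \<open>rep_character\<close> restricts.\<close>
  have \<xi>: "?\<xi> chi = rep_character G (induced_rep n z f)" if "\<And>h. h \<in> D \<Longrightarrow> chi (cls h) = f h" for chi f
    unfolding rep_character_def using metabelian_rep_projection[OF n z, where chi = chi and f = f] that by (intro restrict_ext) simp
  fix \<xi> assume "\<xi> \<in> character_fixed_points G n \<epsilon>"
  moreover from this obtain \<alpha> where \<alpha>: "\<alpha> \<in> hom G (SL n)" "\<xi> = rep_character G \<alpha>"
    by (auto simp: character_fixed_points_def character_variety_def)
  ultimately obtain f where f: "periodic_character n f"
    "\<And>g. g \<in> carrier G \<Longrightarrow> mat_trace (\<alpha> g) = mat_trace (induced_rep n z f g)"
    using fixed_rep_character_eq[OF n z \<alpha>(1)] character_fixed_points_iff[OF n \<alpha>(1)] by auto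
  obtain chi where chi: "?P chi" "\<And>h. h \<in> D \<Longrightarrow> chi (cls h) = f h"
    using quotient_of_periodic_character[OF f(1)] by metis
  have "\<xi> = rep_character G (induced_rep n z f)"
    unfolding \<alpha>(2) rep_character_def using f(2) by (intro restrict_ext)
  also have "\<dots> = ?\<xi> chi"
    using \<xi>[where chi = chi and f = f, OF chi(2)] ..
  finally have "\<xi> = ?\<xi> chi" .
  then show "\<xi> \<in> {?\<xi> chi |chi. ?P chi}" using chi(1) by blast
next
  fix \<xi> assume "\<xi> \<in> {?\<xi> chi |chi. ?P chi}"
  then obtain chi where chi: "?P chi" "\<xi> = ?\<xi> chi" by blast
  define f where "f = (\<lambda>h. chi (cls h))"
  have f: "periodic_character n f"
    using periodic_character_of_quotient[of chi n] chi(1) by (simp add: f_def)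
  have "\<xi> = rep_character G (induced_rep n z f)"
    unfolding chi(2) rep_character_def using metabelian_rep_projection[OF n z, of chi f]
    by (intro restrict_ext) (simp add: f_def)
  moreover have "rep_character G (induced_rep n z f) \<in> character_fixed_points G n \<epsilon>"
    by (subst character_fixed_points_iff[OF n induced_rep_hom[OF n z f]]) (simp add: trace_induced_rep)
  ultimately show "\<xi> \<in> character_fixed_points G n \<epsilon>" by simp
qed

end

section \<open>Application to knot groups\<close>

theorem theorem4:
  fixes S :: "'a::t2_space set" and K :: "real \<Rightarrow> 'a" and F :: "complex \<times> complex \<Rightarrow> 'a"
    and x :: 'a and G :: "(real \<Rightarrow> 'a) set monoid" and m :: "(real \<Rightarrow> 'a) set"
    and \<epsilon> :: "(real \<Rightarrow> 'a) set \<Rightarrow> int" and n :: nat and z :: complex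
  assumes "integral_homology_3_sphere S"
    and "knot_in S K"
    and "tubular_framing S K F"
    and "x \<in> knot_exterior S F"
    and "G = fundamental_group (knot_exterior S F) x"
    and "meridian S F x m"
    and "abelianization G integer_group \<epsilon>"
    and "\<epsilon> m = 1"
    and "n \<ge> 1"
    and "norm z = 1" and "z ^ n = (-1) ^ (n + 1)"
  shows "character_fixed_points G n \<epsilon> =
    {rep_character G (metabelian_rep G m n z chi \<circ> metabelian_projection G m \<epsilon>) |chi.
       chi \<in> hom (alexander_module G) complex_units \<and>
       factors_through_quotient (alexander_module G) (t_power_minus_one G m n) complex_units chi}"
proof -
  interpret group G
    using group_fundamental_group[OF assms(4)] assms(5) by simp
  interpret infinite_cyclic_abelianization G \<epsilon> m
    by unfold_locales (use assms(5-8) in \<open>auto simp: meridian_def\<close>)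
  show ?thesis
    using assms(9,11) by (intro character_fixed_points_eq) auto
qed

end
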